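(* Let $\Bbbk$ be an integral domain of characteristic $0$, $\ell\in\mathbb{Z}_+$, $\varepsilon^{1/2}$ a primitive $\ell$-th root of unity in the algebraic closure of the fraction field of $\Bbbk$, $(M_\varepsilon,\tilde B)$ a root of unity quantum seed, and $\Theta$ a nonempty set of seeds mutation-equivalent to $(M_\varepsilon,\tilde B)$. Assume that $\ell$ is odd and coprime to the diagonal entries of the skew-symmetrizing matrix $D$. Then $$\mathbf{CU}(M_\varepsilon,\tilde B,\mathbf{inv},\Theta)\cong\mathbf{U}(\tilde B,\mathbf{inv},\Theta)_{\Bbbk}:=\bigcap_{(\tilde{\mathbf{x}}'',\tilde B'')\in\Theta}\Bbbk[(x''_i)^{\pm1},x''_j;\ i\in\mathbf{ex}\sqcup\mathbf{inv},\ j\notin\mathbf{ex}\sqcup\mathbf{inv}],$$ where in the intersection $\Theta$ is identified with a subset of the vertices of the exchange graph of $\mathbf{U}(\tilde B,\mathbf{inv})$ via the canonical isomorphism of labelled exchange graphs, and $$\mathbf{CU}_\varepsilon(M_\varepsilon,\tilde B,\mathbf{inv},\Theta)\cong\mathbf{U}(\tilde B,\mathbf{inv},\Theta)_{\Bbbk[\varepsilon^{1/2}]}.$$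
   Context: Fix $N\in\mathbb{Z}_+$, a set $\mathbf{ex}\subseteq[1,N]$ of exchangeable indices and a set $\mathbf{inv}\subseteq[1,N]\setminus\mathbf{ex}$ (frozen indices to be inverted). An exchange matrix is $\tilde B=(b_{ij})\in M_{N\times\mathbf{ex}}(\mathbb{Z})$ whose $\mathbf{ex}\times\mathbf{ex}$ submatrix $B$ (principal part) is such that $DB$ is skew-symmetric for some $D=\mathrm{diag}(d_j,j\in\mathbf{ex})$, $d_j\in\mathbb{Z}_+$. For $k\in\mathbf{ex}$, $\mu_k(\tilde B)=(b'_{ij})$ with $b'_{ij}=-b_{ij}$ if $i=k$ or $j=k$, and $b'_{ij}=b_{ij}+\frac{|b_{ik}|b_{kj}+b_{ik}|b_{kj}|}{2}$ otherwise. **Classical setting.** For an integral domain $A$ of characteristic $0$, let $\mathcal{F}$ be a purely transcendental extension of degree $N$ of the fraction field of $A$. A seed is $(\tilde{\mathbf{x}},\tilde B)$ with $\tilde{\mathbf{x}}=\{x_1,\dots,x_N\}$ a transcendence basis of $\mathcal{F}$ (generating it) and $\tilde B$ an exchange matrix. Mutation at $k\in\mathbf{ex}$ replaces $\tilde B$ by $\mu_k(\tilde B)$ and $x_k$ by $x_k'$ with $x_kx_k'=\prod_{b_{ik}>0}x_i^{b_{ik}}+\prod_{b_{ik}<0}x_i^{-b_{ik}}$. The exchange graph $E(\tilde B)$ of $\mathbf{U}(\tilde B,\mathbf{inv})$ has vertices the seeds obtained from $(\tilde{\mathbf{x}},\tilde B)$ by sequences of mutations and edges the mutations, labelled by $k$.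 $\mathbf{U}(\tilde B,\mathbf{inv},\Theta)_A$ denotes the intersection in the claim with $\Bbbk$ replaced by $A$. **Quantum setting.** $\mathcal{A}_\varepsilon^{1/2}:=\Bbbk[\varepsilon^{1/2}]$. For a skew-symmetric bicharacter $\Lambda:\mathbb{Z}^N\times\mathbb{Z}^N\to\mathbb{Z}/\ell$ (identified with its matrix), the quantum torus $\mathcal{T}_\varepsilon(\Lambda)$ is the $\mathcal{A}_\varepsilon^{1/2}$-algebra with basis $\{X^f\mid f\in\mathbb{Z}^N\}$ and product $X^fX^g=\varepsilon^{\Lambda(f,g)/2}X^{f+g}$. A root of unity toric frame of a division algebra $\mathcal{F}_\varepsilon$ over $\mathbb{Q}(\varepsilon^{1/2})$ is a map $M_\varepsilon:\mathbb{Z}^N\to\mathcal{F}_\varepsilon$ for which there is such a $\Lambda$ (the matrix $\Lambda_{M_\varepsilon}$ of the frame) so that $X^f\mapsto M_\varepsilon(f)$ is an $\mathcal{A}_\varepsilon^{1/2}$-algebra embedding $\mathcal{T}_\varepsilon(\Lambda)\hookrightarrow\mathcal{F}_\varepsilon$ and $\mathcal{F}_\varepsilon$ is the division ring of fractions of the image. A root of unity quantum seed is a pair $(M_\varepsilon,\tilde B)$ such that, for some diagonal matrix $D=\mathrm{diag}(d_j,j\in\mathbf{ex})$ with $d_j\in\mathbb{Z}_+$ and $DB$ skew-symmetric, $B$ being the principal part of $\tilde B$ (this $D$ is the skew-symmetrizing matrix of the claim), the $(i,j)$ entry of $\Lambda_{M_\varepsilon}^\top\tilde B$ modulo $\ell$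 equals $d_j$ if $i=j$ and $0$ otherwise ($i\in[1,N]$, $j\in\mathbf{ex}$). Its mutation at $k\in\mathbf{ex}$ is $(\mu_k(M_\varepsilon),\mu_k(\tilde B))$, where $\mu_k(M_\varepsilon)$ is the toric frame with $\mu_k(M_\varepsilon)(e_i)=M_\varepsilon(e_i)$ for $i\ne k$ and $\mu_k(M_\varepsilon)(e_k)=M_\varepsilon(-e_k+[b^k]_+)+M_\varepsilon(-e_k-[b^k]_-)$; here $b^k$ is the $k$-th column of $\tilde B$, and $[c]_+$, $[c]_-$ are the parts of $c\in\mathbb{Z}^N$ with nonnegative, resp. nonpositive, coordinates. (Its matrix $\Lambda'$ satisfies $\Lambda'(e_i,e_j)=\Lambda(e_i,e_j)$ and $\Lambda'(e_i,e_k)=\Lambda(e_i,-e_k+[b^k]_+)$ for $i,j\neq k$.) The exchange graph $E_\varepsilon$ has vertices the seeds obtained from $(M_\varepsilon,\tilde B)$ by sequences of mutations (the mutation-equivalent ones) and edges the mutations, labelled by $k$. Under the stated assumption on $\ell$ it is known (Nguyen--Trampel--Yakimov) that there is a unique isomorphism of labelled graphs $E_\varepsilon\cong E(\tilde B)$ sending $(M_\varepsilon,\tilde B)$ to $(\tilde{\mathbf{x}},\tilde B)$; this is the canonical isomorphism used in the claim. For a frame $M_\varepsilon$ put (inside the center of $\mathcal{F}_\varepsilon$) $\mathcal{T}(M_\varepsilon)^\ell_\ge:=\Bbbk[M_\varepsilon(e_i)^{\pm\ell},M_\varepsilon(e_j)^\ell;\ i\in\mathbf{ex}\sqcup\mathbf{inv},\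 j\notin\mathbf{ex}\sqcup\mathbf{inv}]$ and $\mathcal{T}_\varepsilon(M_\varepsilon)^\ell_\ge:=\mathcal{A}_\varepsilon^{1/2}[M_\varepsilon(e_i)^{\pm\ell},M_\varepsilon(e_j)^\ell;\ i\in\mathbf{ex}\sqcup\mathbf{inv},\ j\notin\mathbf{ex}\sqcup\mathbf{inv}]$. Then $\mathbf{CU}(M_\varepsilon,\tilde B,\mathbf{inv},\Theta):=\bigcap_{(M''_\varepsilon,\tilde B'')\in\Theta}\mathcal{T}(M''_\varepsilon)^\ell_\ge$ and $\mathbf{CU}_\varepsilon(M_\varepsilon,\tilde B,\mathbf{inv},\Theta):=\bigcap_{(M''_\varepsilon,\tilde B'')\in\Theta}\mathcal{T}_\varepsilon(M''_\varepsilon)^\ell_\ge$. *)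

theory Defs
  imports
    "HOL-Algebra.Algebraic_Closure_Type"
    "HOL-Algebra.Generated_Fields"
    "HOL-Algebra.QuotRing"
    "HOL-Analysis.Finite_Cartesian_Product"
    "HOL-Library.Poly_Mapping"
    "HOL-Number_Theory.Cong"
begin

text \<open>
  Conventions. The index set \<open>[1,N]\<close> is the finite type \<open>'n\<close>. The integral domain is the type
  \<open>'k\<close>, and all coefficient rings (\<open>'k\<close> itself and its extension by \<open>\<epsilon>\<^sup>1\<^sup>/\<^sup>2\<close>) are viewed as
  subrings of the algebraic closure of its fraction field. The root of unity
  \<open>\<epsilon>\<^sup>1\<^sup>/\<^sup>2\<close> itself is called \<open>\<zeta>\<close>, so that \<open>\<epsilon>\<^bsup>m/2\<^esup> = \<zeta> powi m\<close>.
\<close>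

abbreviation unit_vec :: "'n::finite \<Rightarrow> int ^ 'n"
  where "unit_vec i \<equiv> axis i 1"


section \<open>Coefficient rings and algebras\<close>

definition primitive_root_of_unity :: "nat \<Rightarrow> 'a::field \<Rightarrow> bool"
  where "primitive_root_of_unity l z \<longleftrightarrow>
    l > 0 \<and> z ^ l = 1 \<and> (\<forall>m. 0 < m \<and> m < l \<longrightarrow> z ^ m \<noteq> 1)"

definition base_ring :: "'k::idom fract alg_closure set"
  where "base_ring = range (\<lambda>a. to_ac (to_fract a))"

definition cyclotomic_ring :: "'k::idom fract alg_closure \<Rightarrow> 'k fract alg_closure set"
  where "cyclotomic_ring \<zeta> = generate_ring ring_of_type_algebra (insert \<zeta> base_ring)"

definition subring_of_type :: "'a::ring_1 set \<Rightarrow> 'a ring"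
  where "subring_of_type S = ring_of_type_algebra\<lparr>carrier := S\<rparr>"

definition algebra_structure :: "'a::comm_ring_1 set \<Rightarrow> ('a \<Rightarrow> 'b::ring_1) \<Rightarrow> bool"
  where "algebra_structure R \<iota> \<longleftrightarrow>
    \<iota> \<in> ring_hom (subring_of_type R) ring_of_type_algebra \<and>
    (\<forall>a\<in>R. \<forall>z. \<iota> a * z = z * \<iota> a)"

definition generated_subalgebra ::
    "'a::comm_ring_1 set \<Rightarrow> ('a \<Rightarrow> 'b::ring_1) \<Rightarrow> 'b set \<Rightarrow> 'b set"
  where "generated_subalgebra R \<iota> G = generate_ring ring_of_type_algebra (\<iota> ` R \<union> G)"

text \<open>Isomorphism, as \<open>R\<close>-algebras, of subalgebras \<open>S\<close> and \<open>T\<close> of two ambient \<open>R\<close>-algebras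
  with structure maps \<open>\<iota>\<close> and \<open>\<kappa>\<close>.\<close>

definition algebra_isomorphic ::
    "'a::comm_ring_1 set \<Rightarrow> ('a \<Rightarrow> 'b::ring_1) \<Rightarrow> 'b set \<Rightarrow> ('a \<Rightarrow> 'c::ring_1) \<Rightarrow> 'c set \<Rightarrow> bool"
  where "algebra_isomorphic R \<iota> S \<kappa> T \<longleftrightarrow>
    (\<exists>\<phi> \<in> ring_iso (subring_of_type S) (subring_of_type T). \<forall>a\<in>R. \<phi> (\<iota> a) = \<kappa> a)"


section \<open>Exchange matrices\<close>

text \<open>An \<open>N \<times> ex\<close> matrix is encoded as an \<open>N \<times> N\<close> matrix whose columns outside \<open>ex\<close> are zero,
  so that equality of exchange matrices is equality of matrices. Matrix mutation preserves this
  normalisation.\<close>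

definition skew_symmetrized_by :: "'n::finite set \<Rightarrow> ('n \<Rightarrow> int) \<Rightarrow> int ^ 'n ^ 'n \<Rightarrow> bool"
  where "skew_symmetrized_by ex d B \<longleftrightarrow>
    (\<forall>i. \<forall>j. j \<notin> ex \<longrightarrow> B $ i $ j = 0) \<and>
    (\<forall>j\<in>ex. d j > 0) \<and>
    (\<forall>i\<in>ex. \<forall>j\<in>ex. d i * B $ i $ j = - (d j * B $ j $ i))"

definition exchange_matrix :: "'n::finite set \<Rightarrow> int ^ 'n ^ 'n \<Rightarrow> bool"
  where "exchange_matrix ex B \<longleftrightarrow> (\<exists>d. skew_symmetrized_by ex d B)"

text \<open>The numerator below is always even, so the integer division is exact.\<close>

definition matrix_mutation :: "'n::finite \<Rightarrow> int ^ 'n ^ 'n \<Rightarrow> int ^ 'n ^ 'n"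
  where "matrix_mutation k B = (\<chi> i j.
    if i = k \<or> j = k then - B $ i $ j
    else B $ i $ j + (\<bar>B $ i $ k\<bar> * B $ k $ j + B $ i $ k * \<bar>B $ k $ j\<bar>) div 2)"

definition nonneg_part :: "int ^ 'n::finite \<Rightarrow> int ^ 'n"
  where "nonneg_part c = (\<chi> i. max (c $ i) 0)"

definition nonpos_part :: "int ^ 'n::finite \<Rightarrow> int ^ 'n"
  where "nonpos_part c = (\<chi> i. min (c $ i) 0)"


section \<open>Labelled exchange graphs\<close>

text \<open>\<open>E k s t\<close> means that \<open>t\<close> is the mutation of \<open>s\<close> at \<open>k\<close>. Seed mutations are involutive, so
  this relation describes the undirected edges with label \<open>k\<close>.\<close>

definition mutation_class :: "'n set \<Rightarrow> ('n \<Rightarrow> 's \<Rightarrow> 's \<Rightarrow> bool) \<Rightarrow> 's \<Rightarrow> 's set"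
  where "mutation_class ex E s = {t. (\<lambda>u v. \<exists>k\<in>ex. E k u v)\<^sup>*\<^sup>* s t}"

definition exchange_graph_iso ::
    "'n set \<Rightarrow> ('n \<Rightarrow> 's \<Rightarrow> 's \<Rightarrow> bool) \<Rightarrow> 's \<Rightarrow> ('n \<Rightarrow> 't \<Rightarrow> 't \<Rightarrow> bool) \<Rightarrow> 't \<Rightarrow> ('s \<Rightarrow> 't) \<Rightarrow> bool"
  where "exchange_graph_iso ex E s E' s' \<sigma> \<longleftrightarrow>
    bij_betw \<sigma> (mutation_class ex E s) (mutation_class ex E' s') \<and>
    (\<forall>k\<in>ex. \<forall>u\<in>mutation_class ex E s. \<forall>v\<in>mutation_class ex E s.
       E k u v \<longleftrightarrow> E' k (\<sigma> u) (\<sigma> v)) \<and>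
    \<sigma> s = s'"


section \<open>Classical seeds\<close>

type_synonym ('g, 'n) seed = "('n \<Rightarrow> 'g) \<times> (int ^ 'n ^ 'n)"

definition fraction_subfield :: "'a set \<Rightarrow> ('a \<Rightarrow> 'g::field) \<Rightarrow> 'g set"
  where "fraction_subfield R \<kappa> = generate_field ring_of_type_algebra (\<kappa> ` R)"

text \<open>No nonzero polynomial with coefficients in \<open>K\<close> vanishes at \<open>x\<close>; an exponent vector
  \<open>m :: 'n \<Rightarrow> nat\<close> encodes the monomial \<open>\<Prod>i. x i ^ m i\<close>.\<close>

definition algebraically_independent :: "'g::field set \<Rightarrow> ('n::finite \<Rightarrow> 'g) \<Rightarrow> bool"
  where "algebraically_independent K x \<longleftrightarrow>
    (\<forall>p :: ('n \<Rightarrow> nat) \<Rightarrow>\<^sub>0 'g.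
       range (Poly_Mapping.lookup p) \<subseteq> K \<and>
       (\<Sum>m\<in>Poly_Mapping.keys p. Poly_Mapping.lookup p m * (\<Prod>i\<in>UNIV. x i ^ m i)) = 0
       \<longrightarrow> p = 0)"

text \<open>\<open>\<kappa>\<close> embeds \<open>R\<close> into \<open>'g\<close>. The existence of a generating transcendence basis indexed by
  \<open>'n\<close> says that \<open>'g\<close> is purely transcendental of degree \<open>N\<close> over the fraction field.\<close>

definition classical_seed ::
    "'a::comm_ring_1 set \<Rightarrow> ('a \<Rightarrow> 'g::field) \<Rightarrow> 'n::finite set \<Rightarrow> ('g, 'n) seed \<Rightarrow> bool"
  where "classical_seed R \<kappa> ex = (\<lambda>(x, B).
    algebra_structure R \<kappa> \<and> inj_on \<kappa> R \<and>
    algebraically_independent (fraction_subfield R \<kappa>) x \<and>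
    generate_field ring_of_type_algebra (fraction_subfield R \<kappa> \<union> range x) = UNIV \<and>
    exchange_matrix ex B)"

definition seed_mutation :: "'n::finite \<Rightarrow> ('g::field, 'n) seed \<Rightarrow> ('g, 'n) seed"
  where "seed_mutation k = (\<lambda>(x, B).
    (x(k := ((\<Prod>i | B $ i $ k > 0. x i ^ nat (B $ i $ k)) +
             (\<Prod>i | B $ i $ k < 0. x i ^ nat (- B $ i $ k))) / x k),
     matrix_mutation k B))"

definition seed_edge :: "'n::finite \<Rightarrow> ('g::field, 'n) seed \<Rightarrow> ('g, 'n) seed \<Rightarrow> bool"
  where "seed_edge k s t \<longleftrightarrow> t = seed_mutation k s"

definition upper_cluster_algebra ::
    "'a::comm_ring_1 set \<Rightarrow> ('a \<Rightarrow> 'g::field) \<Rightarrow> 'n::finite set \<Rightarrow> 'n set \<Rightarrow> ('g, 'n) seed set \<Rightarrow> 'g set"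
  where "upper_cluster_algebra R \<kappa> ex iv \<Theta> = (\<Inter>(x, B)\<in>\<Theta>.
    generated_subalgebra R \<kappa> (range x \<union> (\<lambda>i. inverse (x i)) ` (ex \<union> iv)))"


section \<open>Root of unity quantum seeds\<close>

type_synonym ('f, 'n) quantum_seed = "(int ^ 'n \<Rightarrow> 'f) \<times> (int ^ 'n ^ 'n)"

text \<open>A bicharacter with values in \<open>\<int>/\<ell>\<close> is represented by an integer matrix, whose entries
  matter only modulo \<open>\<ell>\<close>.\<close>

definition bicharacter :: "int ^ 'n::finite ^ 'n \<Rightarrow> int ^ 'n \<Rightarrow> int ^ 'n \<Rightarrow> int"
  where "bicharacter \<Lambda> f g = (\<Sum>i\<in>UNIV. \<Sum>j\<in>UNIV. f $ i * \<Lambda> $ i $ j * g $ j)"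

text \<open>The element \<open>\<Sum>f. p\<^sub>f X\<^sup>f\<close> of the quantum torus is the finitely supported function \<open>p\<close>.\<close>

definition torus_mult ::
    "'a::field \<Rightarrow> int ^ 'n::finite ^ 'n \<Rightarrow> (int ^ 'n \<Rightarrow>\<^sub>0 'a) \<Rightarrow> (int ^ 'n \<Rightarrow>\<^sub>0 'a) \<Rightarrow> (int ^ 'n \<Rightarrow>\<^sub>0 'a)"
  where "torus_mult \<zeta> \<Lambda> p q =
    (\<Sum>f\<in>Poly_Mapping.keys p. \<Sum>g\<in>Poly_Mapping.keys q.
       Poly_Mapping.single (f + g)
         (Poly_Mapping.lookup p f * Poly_Mapping.lookup q g * \<zeta> powi bicharacter \<Lambda> f g))"

definition quantum_torus ::
    "'k::idom fract alg_closure \<Rightarrow> int ^ 'n::finite ^ 'n \<Rightarrow> (int ^ 'n \<Rightarrow>\<^sub>0 'k fract alg_closure) ring"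
  where "quantum_torus \<zeta> \<Lambda> =
    \<lparr>carrier = {p. range (Poly_Mapping.lookup p) \<subseteq> cyclotomic_ring \<zeta>},
     monoid.mult = torus_mult \<zeta> \<Lambda>, one = Poly_Mapping.single 0 1,
     ring.zero = 0, ring.add = (+)\<rparr>"

definition frame_map ::
    "('a::zero \<Rightarrow> 'f::ring_1) \<Rightarrow> (int ^ 'n::finite \<Rightarrow> 'f) \<Rightarrow> (int ^ 'n \<Rightarrow>\<^sub>0 'a) \<Rightarrow> 'f"
  where "frame_map \<iota> M p =
    (\<Sum>f\<in>Poly_Mapping.keys p. \<iota> (Poly_Mapping.lookup p f) * M f)"

text \<open>\<open>M\<close> is a root of unity toric frame with matrix \<open>\<Lambda>\<close>, in the division ring \<open>'f\<close> with the
  \<open>cyclotomic_ring \<zeta>\<close>-algebra structure \<open>\<iota>\<close>. Since \<open>frame_map\<close> is injective, so is \<open>\<iota>\<close>, which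
  therefore extends uniquely to an algebra structure over the fraction field of
  \<open>cyclotomic_ring \<zeta>\<close>, in particular over \<open>\<rat>(\<zeta>)\<close>. As quantum tori are Ore domains, right
  fractions suffice for the division ring of fractions.\<close>

definition toric_frame_with_matrix ::
    "nat \<Rightarrow> 'k::idom fract alg_closure \<Rightarrow> ('k fract alg_closure \<Rightarrow> 'f::division_ring) \<Rightarrow>
     int ^ 'n::finite ^ 'n \<Rightarrow> (int ^ 'n \<Rightarrow> 'f) \<Rightarrow> bool"
  where "toric_frame_with_matrix l \<zeta> \<iota> \<Lambda> M \<longleftrightarrow>
    (\<forall>i j. [\<Lambda> $ j $ i = - \<Lambda> $ i $ j] (mod int l)) \<and>
    frame_map \<iota> M \<in> ring_hom (quantum_torus \<zeta> \<Lambda>) ring_of_type_algebra \<and>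
    inj_on (frame_map \<iota> M) (carrier (quantum_torus \<zeta> \<Lambda>)) \<and>
    (\<forall>z. \<exists>a \<in> frame_map \<iota> M ` carrier (quantum_torus \<zeta> \<Lambda>).
         \<exists>b \<in> frame_map \<iota> M ` carrier (quantum_torus \<zeta> \<Lambda>). b \<noteq> 0 \<and> z = a * inverse b)"

definition toric_frame ::
    "nat \<Rightarrow> 'k::idom fract alg_closure \<Rightarrow> ('k fract alg_closure \<Rightarrow> 'f::division_ring) \<Rightarrow>
     (int ^ 'n::finite \<Rightarrow> 'f) \<Rightarrow> bool"
  where "toric_frame l \<zeta> \<iota> M \<longleftrightarrow> (\<exists>\<Lambda>. toric_frame_with_matrix l \<zeta> \<iota> \<Lambda> M)"

text \<open>The matrix \<open>\<Lambda>\<close> of a frame is unique modulo \<open>\<ell>\<close> when \<open>\<zeta>\<close> is a primitive \<open>\<ell>\<close>-th root of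
  unity. The skew-symmetrizing matrix \<open>D = diag(d\<^sub>j)\<close> is a parameter.\<close>

definition is_quantum_seed ::
    "nat \<Rightarrow> 'k::idom fract alg_closure \<Rightarrow> ('k fract alg_closure \<Rightarrow> 'f::division_ring) \<Rightarrow>
     'n::finite set \<Rightarrow> ('n \<Rightarrow> int) \<Rightarrow> ('f, 'n) quantum_seed \<Rightarrow> bool"
  where "is_quantum_seed l \<zeta> \<iota> ex d = (\<lambda>(M, B).
    skew_symmetrized_by ex d B \<and>
    (\<exists>\<Lambda>. toric_frame_with_matrix l \<zeta> \<iota> \<Lambda> M \<and>
         (\<forall>i. \<forall>j\<in>ex. [(transpose \<Lambda> ** B) $ i $ j = (if i = j then d j else 0)] (mod int l))))"

text \<open>\<open>quantum_mutation l \<zeta> \<iota> k s t\<close>: the quantum seed \<open>t\<close> is the mutation of \<open>s\<close> at \<open>k\<close>. For \<open>\<zeta>\<close> a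
  primitive \<open>\<ell>\<close>-th root of unity with \<open>\<ell>\<close> odd, the commutation relations of the \<open>M' (unit_vec i)\<close>
  determine the matrix of \<open>M'\<close> modulo \<open>\<ell>\<close>, so the toric frame \<open>M'\<close> is determined by its values
  on the unit vectors.\<close>

definition quantum_mutation ::
    "nat \<Rightarrow> 'k::idom fract alg_closure \<Rightarrow> ('k fract alg_closure \<Rightarrow> 'f::division_ring) \<Rightarrow>
     'n::finite \<Rightarrow> ('f, 'n) quantum_seed \<Rightarrow> ('f, 'n) quantum_seed \<Rightarrow> bool"
  where "quantum_mutation l \<zeta> \<iota> k = (\<lambda>(M, B) (M', B').
    toric_frame l \<zeta> \<iota> M' \<and>
    (\<forall>i. i \<noteq> k \<longrightarrow> M' (unit_vec i) = M (unit_vec i)) \<and>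
    M' (unit_vec k) =
      M (- unit_vec k + nonneg_part (column k B)) + M (- unit_vec k - nonpos_part (column k B)) \<and>
    B' = matrix_mutation k B)"

text \<open>With \<open>R = base_ring\<close> this is \<open>CU\<close>, with \<open>R = cyclotomic_ring \<zeta>\<close> it is \<open>CU\<^sub>\<epsilon>\<close>.\<close>

definition central_upper_cluster_algebra ::
    "'a::comm_ring_1 set \<Rightarrow> ('a \<Rightarrow> 'f::division_ring) \<Rightarrow> nat \<Rightarrow> 'n::finite set \<Rightarrow> 'n set \<Rightarrow>
     ('f, 'n) quantum_seed set \<Rightarrow> 'f set"
  where "central_upper_cluster_algebra R \<iota> l ex iv \<Theta> = (\<Inter>(M, B)\<in>\<Theta>.
    generated_subalgebra R \<iota>
      (range (\<lambda>i. M (unit_vec i) ^ l) \<union> (\<lambda>i. inverse (M (unit_vec i) ^ l)) ` (ex \<union> iv)))"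

end

theory Submission
  imports Defs
begin

text \<open>
  The \<open>\<ell>\<close>-th powers \<open>M(e\<^sub>i)\<^sup>\<ell> = M(\<ell>e\<^sub>i)\<close> commute, and they are algebraically independent over the
  coefficient ring because a toric frame is injective. Hence \<open>x\<^sub>i \<mapsto> M(e\<^sub>i)\<^sup>\<ell>\<close> extends to an embedding
  \<open>\<psi>\<close> of the field of rational functions into the division ring. In a quantum mutation the two
  summands \<open>u, v\<close> of \<open>M'(e\<^sub>k)\<close> satisfy \<open>u v = q v u\<close> with \<open>q = \<zeta>\<close> raised to \<open>-2d\<^sub>k\<close>, a primitive
  \<open>\<ell>\<close>-th root of unity since \<open>\<ell>\<close> is odd and coprime to \<open>d\<^sub>k\<close>; so \<open>(u + v)\<^sup>\<ell> = u\<^sup>\<ell> + v\<^sup>\<ell>\<close>, which is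
  the classical exchange relation between the \<open>\<ell>\<close>-th powers. Therefore \<open>\<psi>\<close> maps the cluster variables
  of every classical seed to the \<open>\<ell>\<close>-th powers of the corresponding quantum seed, and the upper
  cluster algebra onto the central one.
\<close>

section \<open>The quantum binomial theorem at a root of unity\<close>

text \<open>\<open>R\<close> is a subset because all coefficient rings lie in one algebraically
  closed field. Centrality lets coefficients move past the noncommuting elements of the
  target.\<close>

locale algebra_map =
  fixes R :: "'a::comm_ring_1 set" and h :: "'a \<Rightarrow> 'b::ring_1"
  assumes one_closed: "1 \<in> R"
    and add_closed: "a \<in> R \<Longrightarrow> b \<in> R \<Longrightarrow> a + b \<in> R"
    and mult_closed: "a \<in> R \<Longrightarrow> b \<in> R \<Longrightarrow> a * b \<in> R"
    and uminus_closed: "a \<in> R \<Longrightarrow> - a \<in> R"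
    and map_one: "h 1 = 1"
    and map_add: "a \<in> R \<Longrightarrow> b \<in> R \<Longrightarrow> h (a + b) = h a + h b"
    and map_mult: "a \<in> R \<Longrightarrow> b \<in> R \<Longrightarrow> h (a * b) = h a * h b"
    and map_central: "a \<in> R \<Longrightarrow> h a * z = z * h a"
begin

lemma zero_closed: "0 \<in> R"
  using add_closed[OF one_closed uminus_closed[OF one_closed]] by simp

lemma map_zero: "h 0 = 0"
  using map_add[OF zero_closed zero_closed] by simp

lemma map_uminus: "a \<in> R \<Longrightarrow> h (- a) = - h a"
  using map_add[of a "- a"] uminus_closed map_zero by (simp add: eq_neg_iff_add_eq_0 add.commute)

lemma power_closed: "a \<in> R \<Longrightarrow> a ^ n \<in> R"
  by (induction n) (auto intro: one_closed mult_closed)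

end

section \<open>Gaussian binomial coefficients\<close>

text \<open>\<open>gaussian_coeff q i j\<close> is the Gaussian binomial coefficient \<open>i + j\<close> choose \<open>i\<close>; indexing by
  both parts avoids truncated subtraction.\<close>

fun gaussian_coeff :: "'a::comm_ring_1 \<Rightarrow> nat \<Rightarrow> nat \<Rightarrow> 'a"
  where "gaussian_coeff q 0 j = 1"
  | "gaussian_coeff q (Suc i) 0 = 1"
  | "gaussian_coeff q (Suc i) (Suc j) =
      q ^ Suc i * gaussian_coeff q (Suc i) j + gaussian_coeff q i (Suc j)"

lemma gaussian_coeff_0_right [simp]: "gaussian_coeff q i 0 = 1"
  by (cases i) auto

text \<open>The two identities support each other: for a smaller pair both have the same right-hand
  side, so the two Gaussian coefficients in the defining recursion can be traded for one another. No
  division occurs, so \<open>q\<close> may be a root of unity.\<close>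

lemma gaussian_coeff_absorb:
  "(1 - q ^ Suc i) * gaussian_coeff q (Suc i) j = (1 - q ^ Suc (i + j)) * gaussian_coeff q i j"
  "(1 - q ^ Suc j) * gaussian_coeff q i (Suc j) = (1 - q ^ Suc (i + j)) * gaussian_coeff q i j"
proof (induction "i + j" arbitrary: i j rule: less_induct)
  case less
  {
    case 1
    show ?case
    proof (cases j)
      case (Suc j')
      have a: "(1 - q ^ Suc i) * gaussian_coeff q (Suc i) j' = (1 - q ^ Suc (i + j')) * gaussian_coeff q i j'"
        and b: "(1 - q ^ Suc j') * gaussian_coeff q i (Suc j') = (1 - q ^ Suc (i + j')) * gaussian_coeff q i j'"
        using less[of i j'] Suc by auto
      have "(1 - q ^ Suc i) * gaussian_coeff q (Suc i) (Suc j') =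
        q ^ Suc i * ((1 - q ^ Suc i) * gaussian_coeff q (Suc i) j') + (1 - q ^ Suc i) * gaussian_coeff q i (Suc j')"
        by (simp only: gaussian_coeff.simps) (simp add: algebra_simps)
      also have "\<dots> = q ^ Suc i * ((1 - q ^ Suc j') * gaussian_coeff q i (Suc j')) + (1 - q ^ Suc i) * gaussian_coeff q i (Suc j')"
        by (simp only: a b)
      also have "\<dots> = (1 - q ^ Suc (i + Suc j')) * gaussian_coeff q i (Suc j')"
        by (simp add: algebra_simps power_add)
      finally show ?thesis using Suc by simp
    qed auto
  next
    case 2
    show ?case
    proof (cases i)
      case (Suc i')
      have a: "(1 - q ^ Suc i') * gaussian_coeff q (Suc i') j = (1 - q ^ Suc (i' + j)) * gaussian_coeff q i' j"
        and b: "(1 - q ^ Suc j) * gaussian_coeff q i' (Suc j) = (1 - q ^ Suc (i' + j)) * gaussian_coeff q i' j"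
        using less[of i' j] Suc by auto
      have "(1 - q ^ Suc j) * gaussian_coeff q (Suc i') (Suc j) =
        q ^ Suc i' * (1 - q ^ Suc j) * gaussian_coeff q (Suc i') j + (1 - q ^ Suc j) * gaussian_coeff q i' (Suc j)"
        by (simp only: gaussian_coeff.simps) (simp add: algebra_simps)
      also have "\<dots> = q ^ Suc i' * (1 - q ^ Suc j) * gaussian_coeff q (Suc i') j + (1 - q ^ Suc i') * gaussian_coeff q (Suc i') j"
        by (simp only: a b)
      also have "\<dots> = (1 - q ^ Suc (Suc i' + j)) * gaussian_coeff q (Suc i') j"
        by (simp add: algebra_simps power_add)
      finally show ?thesis using Suc by simp
    qed auto
  }
qed

text \<open>In the absorption identity the factor \<open>1 - q ^ (i + j)\<close> vanishes, while
  \<open>1 - q ^ i\<close> does not because \<open>0 < i < i + j\<close>.\<close>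

lemma gaussian_coeff_primitive_root:
  fixes q :: "'a::field"
  assumes "primitive_root_of_unity (i + j) q" "0 < i" "0 < j"
  shows "gaussian_coeff q i j = 0"
proof -
  obtain i' where i: "i = Suc i'" using assms(2) by (cases i) auto
  have "q ^ Suc (i' + j) = 1" "q ^ Suc i' \<noteq> 1"
    using assms i by (simp_all add: primitive_root_of_unity_def del: power_Suc)
  then show ?thesis using gaussian_coeff_absorb(1)[of q i' j] i by auto
qed

section \<open>Powers of a sum of two q-commuting elements\<close>

context algebra_map
begin

lemma gaussian_coeff_closed: "q \<in> R \<Longrightarrow> gaussian_coeff q i j \<in> R"
  by (induction q i j rule: gaussian_coeff.induct)
     (auto intro!: one_closed mult_closed add_closed power_closed simp del: power_Suc)

lemma q_commute_power:
  assumes "q \<in> R" "u * v = h q * (v * u)"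
  shows "u * v ^ n = h (q ^ n) * (v ^ n * u)"
proof (induction n)
  case (Suc n)
  have "u * v ^ Suc n = (u * v ^ n) * v"
    by (simp only: power_Suc2 mult.assoc)
  also have "\<dots> = h (q ^ n) * (v ^ n * (u * v))"
    by (simp only: Suc.IH mult.assoc)
  also have "\<dots> = h (q ^ n) * (v ^ n * h q) * (v * u)"
    by (simp only: assms(2) mult.assoc)
  also have "v ^ n * h q = h q * v ^ n"
    using assms(1) by (simp only: map_central)
  also have "h (q ^ n) * (h q * v ^ n) * (v * u) = h (q ^ n) * h q * ((v ^ n * v) * u)"
    by (simp only: mult.assoc)
  also have "\<dots> = h (q ^ Suc n) * (v ^ Suc n * u)"
    using assms(1) by (simp only: map_mult power_closed power_Suc2)
  finally show ?case .
qed (simp add: map_one)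

text \<open>Monomials keep \<open>v\<close> before \<open>u\<close>, and the new factor is
  multiplied on the left: \<open>u\<close> crosses \<open>v ^ i\<close> at the cost of
  \<open>q ^ i\<close>, whereas \<open>v\<close> only raises \<open>i\<close>. These are the two
  terms in the recursion of \<open>gaussian_coeff\<close>.\<close>

lemma q_binomial:
  assumes q: "q \<in> R" and uv: "u * v = h q * (v * u)"
  shows "(u + v) ^ n = (\<Sum>i\<le>n. h (gaussian_coeff q i (n - i)) * (v ^ i * u ^ (n - i)))"
proof (induction n)
  case (Suc n)
  let ?c = "\<lambda>i j. gaussian_coeff q i j"
  let ?t = "\<lambda>i j. v ^ i * u ^ j"
  have c: "h (?c i j) * z = z * h (?c i j)" for i j z
    using q by (intro map_central gaussian_coeff_closed)
  have U: "u * (h (?c i (n - i)) * ?t i (n - i)) = h (q ^ i * ?c i (n - i)) * ?t i (Suc n - i)" if "i \<le> n" for i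
  proof -
    have "u * (h (?c i (n - i)) * ?t i (n - i)) = (u * h (?c i (n - i))) * ?t i (n - i)"
      by (simp only: mult.assoc)
    also have "\<dots> = h (?c i (n - i)) * ((u * v ^ i) * u ^ (n - i))"
      by (simp only: c[of i "n - i" u, symmetric]) (simp only: mult.assoc)
    also have "\<dots> = h (?c i (n - i)) * h (q ^ i) * ?t i (Suc (n - i))"
      by (simp only: q_commute_power[OF q uv, of i]) (simp only: mult.assoc power_Suc)
    also have "h (?c i (n - i)) * h (q ^ i) = h (q ^ i * ?c i (n - i))"
      using q by (simp add: map_mult[symmetric] power_closed gaussian_coeff_closed mult.commute)
    finally show ?thesis using that by (simp add: Suc_diff_le)
  qed
  have V: "v * (h (?c i (n - i)) * ?t i (n - i)) = h (?c i (n - i)) * ?t (Suc i) (n - i)" for i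
  proof -
    have "v * (h (?c i (n - i)) * ?t i (n - i)) = (v * h (?c i (n - i))) * ?t i (n - i)"
      by (simp only: mult.assoc)
    then show ?thesis by (simp only: c[of i "n - i" v, symmetric]) (simp only: mult.assoc power_Suc)
  qed
  have "(u + v) ^ Suc n = (\<Sum>i\<le>n. h (q ^ i * ?c i (n - i)) * ?t i (Suc n - i))
      + (\<Sum>i\<le>n. h (?c i (n - i)) * ?t (Suc i) (n - i))"
    unfolding power_Suc[of "u + v"] Suc.IH distrib_right sum_distrib_left V sum.distrib
    by (rule arg_cong2[where f = plus], rule sum.cong) (auto intro: U)
  \<comment> \<open>Both sums are padded with a zero term to the range up to \<open>Suc n\<close>,
    this one after an index shift, so that they can be added term by term.\<close>
  also have "(\<Sum>i\<le>n. h (?c i (n - i)) * ?t (Suc i) (n - i))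
      = (\<Sum>i\<le>Suc n. if i = 0 then 0 else h (?c (i - 1) (Suc n - i)) * ?t i (Suc n - i))"
    by (simp add: sum.atMost_Suc_shift del: sum.atMost_Suc)
  also have "(\<Sum>i\<le>n. h (q ^ i * ?c i (n - i)) * ?t i (Suc n - i))
      = (\<Sum>i\<le>Suc n. if i = Suc n then 0 else h (q ^ i * ?c i (n - i)) * ?t i (Suc n - i))"
    by simp
  finally have "(u + v) ^ Suc n = (\<Sum>i\<le>Suc n.
      (if i = Suc n then 0 else h (q ^ i * ?c i (n - i)) * ?t i (Suc n - i)) +
      (if i = 0 then 0 else h (?c (i - 1) (Suc n - i)) * ?t i (Suc n - i)))"
    by (simp add: sum.distrib del: sum.atMost_Suc)
  also have "\<dots> = (\<Sum>i\<le>Suc n. h (?c i (Suc n - i)) * ?t i (Suc n - i))"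
  proof (rule sum.cong[OF refl])
    fix i assume i: "i \<in> {..Suc n}"
    \<comment> \<open>At either end only one summand survives, with coefficient 1. In between,
      \<open>j = n - i\<close> puts the coefficients into the shape of the recursion.\<close>
    consider "i = 0" | "i = Suc n" "i \<noteq> 0" | i' j where "i = Suc i'" "n = Suc i' + j"
    proof (cases i)
      case (Suc i')
      then have "i' = n \<or> Suc i' + (n - Suc i') = n" using i by auto
      then show thesis using Suc that(2) that(3)[of i' "n - Suc i'"] by auto
    qed
    then show "(if i = Suc n then 0 else h (q ^ i * ?c i (n - i)) * ?t i (Suc n - i)) +
      (if i = 0 then 0 else h (?c (i - 1) (Suc n - i)) * ?t i (Suc n - i)) =
      h (?c i (Suc n - i)) * ?t i (Suc n - i)"
    proof cases
      case 3
      have [simp]: "Suc (i' + j) - i' = Suc j" by simp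
      have "h (?c (Suc i') (Suc j)) = h (q ^ Suc i' * ?c (Suc i') j) + h (?c i' (Suc j))"
        unfolding gaussian_coeff.simps
        by (intro map_add mult_closed power_closed gaussian_coeff_closed q)
      then show ?thesis using 3 by (simp add: distrib_right del: gaussian_coeff.simps power_Suc)
    qed (auto simp: map_one)
  qed
  finally show ?case .
qed (simp add: map_one)

end

text \<open>In the binomial expansion only the terms with index \<open>0\<close> and
  \<open>l\<close> survive; all other Gaussian coefficients vanish at a primitive root.\<close>

lemma primitive_root_power_add:
  fixes h :: "'a::field \<Rightarrow> 'b::ring_1"
  assumes "algebra_map R h" "q \<in> R" "primitive_root_of_unity l q" "u * v = h q * (v * u)"
  shows "(u + v) ^ l = u ^ l + v ^ l"
proof -
  interpret algebra_map R h by fact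
  obtain n where l: "l = Suc n"
    using assms(3) by (cases l) (auto simp: primitive_root_of_unity_def)
  have "h (gaussian_coeff q (Suc i) (n - i)) = 0" if "i < n" for i
    using gaussian_coeff_primitive_root[of "Suc i" "n - i" q] assms(3) l that by (simp add: map_zero)
  then have "(\<Sum>i\<le>l. h (gaussian_coeff q i (l - i)) * (v ^ i * u ^ (l - i))) = u ^ l + v ^ l"
    unfolding l sum.atMost_Suc_shift by (simp add: map_one lessThan_Suc_atMost[symmetric])
  then show ?thesis
    using q_binomial[OF assms(2,4)] by simp
qed

section \<open>Polynomials and their fractions\<close>

lemma ring_of_type_algebra_simps [simp]:
  "carrier ring_of_type_algebra = UNIV" "\<one>\<^bsub>ring_of_type_algebra\<^esub> = 1" "\<zero>\<^bsub>ring_of_type_algebra\<^esub> = 0"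
  "a \<oplus>\<^bsub>ring_of_type_algebra\<^esub> b = a + b" "a \<otimes>\<^bsub>ring_of_type_algebra\<^esub> b = a * b"
  by (simp_all add: ring_of_type_algebra_def)

lemma a_inv_ring_of_type_algebra [simp]: "\<ominus>\<^bsub>ring_of_type_algebra\<^esub> (a::'a::ring_1) = - a"
proof -
  have "\<exists>y. x + y = 0 \<and> y + x = 0" for x :: 'a
    by (rule exI[of _ "- x"]) simp
  then interpret ring "ring_of_type_algebra :: 'a ring"
    by unfold_locales (auto simp: algebra_simps Units_def)
  show ?thesis
    using minus_equality[of "- a" a] by simp
qed

lemma m_inv_ring_of_type_algebra [simp]:
  "a \<noteq> 0 \<Longrightarrow> inv\<^bsub>ring_of_type_algebra\<^esub> (a::'a::field) = inverse a"
proof -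
  assume "a \<noteq> 0"
  interpret field "ring_of_type_algebra :: 'a ring" by (rule field_from_type_algebra)
  show ?thesis
    using comm_inv_char[of a "inverse a"] \<open>a \<noteq> 0\<close> by simp
qed

lemma algebra_mapI:
  assumes "algebra_structure R h" "1 \<in> R" "\<And>a b. a \<in> R \<Longrightarrow> b \<in> R \<Longrightarrow> a + b \<in> R"
    "\<And>a b. a \<in> R \<Longrightarrow> b \<in> R \<Longrightarrow> a * b \<in> R" "\<And>a. a \<in> R \<Longrightarrow> - a \<in> R"
  shows "algebra_map R h"
proof -
  have hom: "h \<in> ring_hom (subring_of_type R) ring_of_type_algebra"
    and central: "\<And>a z. a \<in> R \<Longrightarrow> h a * z = z * h a"
    using assms(1) unfolding algebra_structure_def by blast+
  show ?thesis
    by (rule algebra_map.intro[OF assms(2-5) _ _ _ central])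
       (use hom in \<open>auto simp: ring_hom_def subring_of_type_def\<close>)
qed

text \<open>\<open>P\<close> is the graph of an injective ring homomorphism from a subring of the
  field to the division ring. It extends to fractions because its image is commutative, although the
  division ring need not be; it is then defined everywhere because the generators lie in its
  domain.\<close>

lemma fraction_extension:
  fixes P :: "'g::field \<Rightarrow> 'f::division_ring \<Rightarrow> bool"
  assumes one: "P 1 1"
    and add: "\<And>a a' b b'. P a a' \<Longrightarrow> P b b' \<Longrightarrow> P (a + b) (a' + b')"
    and mult: "\<And>a a' b b'. P a a' \<Longrightarrow> P b b' \<Longrightarrow> P (a * b) (a' * b')"
    and uminus: "\<And>a a'. P a a' \<Longrightarrow> P (- a) (- a')"
    and zero: "\<And>a a'. P a a' \<Longrightarrow> a = 0 \<longleftrightarrow> a' = 0"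
    and gen: "generate_field ring_of_type_algebra G = UNIV"
    and G: "\<And>a. a \<in> G \<Longrightarrow> \<exists>a'. P a a'"
  obtains \<psi> where "\<psi> 1 = 1" "\<And>a b. \<psi> (a + b) = \<psi> a + \<psi> b" "\<And>a b. \<psi> (a * b) = \<psi> a * \<psi> b"
    "inj \<psi>" "\<And>a a'. P a a' \<Longrightarrow> \<psi> a = a'"
proof -
  \<comment> \<open>The commutator of \<open>a\<close> and \<open>b\<close> is zero in the field, so
    its partner is zero as well.\<close>
  have comm: "a' * b' = b' * a'" if "P a a'" "P b b'" for a a' b b'
  proof -
    have "P (a * b + - (b * a)) (a' * b' + - (b' * a'))"
      using that by (intro add mult uminus)
    from zero[OF this] show ?thesis by simp
  qed
  \<comment> \<open>\<open>Q\<close> relates two fractions with corresponding numerators and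
    denominators, written without division.\<close>
  define Q where "Q g f \<longleftrightarrow> (\<exists>a a' b b'. P a a' \<and> P b b' \<and> b \<noteq> 0 \<and> b' \<noteq> 0 \<and> g * b = a \<and> f * b' = a')" for g f
  have QI: "Q g f" if "P (g * b) (f * b')" "P b b'" "b \<noteq> 0" for g f b b'
    using that zero unfolding Q_def by blast
  have QE: thesis if "Q g f" "\<And>b b'. P (g * b) (f * b') \<Longrightarrow> P b b' \<Longrightarrow> b \<noteq> 0 \<Longrightarrow> b' \<noteq> 0 \<Longrightarrow> thesis" for g f thesis
    using that unfolding Q_def by blast
  have Q_P: "Q a a'" if "P a a'" for a a'
    using QI[of a 1 a' 1] that one by simp
  have Q_add: "Q (g1 + g2) (f1 + f2)" if "Q g1 f1" "Q g2 f2" for g1 g2 f1 f2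
  proof -
    obtain b b' where b: "P (g1 * b) (f1 * b')" "P b b'" "b \<noteq> 0" "b' \<noteq> 0" using \<open>Q g1 f1\<close> by (rule QE)
    obtain c c' where c: "P (g2 * c) (f2 * c')" "P c c'" "c \<noteq> 0" "c' \<noteq> 0" using \<open>Q g2 f2\<close> by (rule QE)
    have "P (g1 * b * c + g2 * c * b) (f1 * b' * c' + f2 * c' * b')"
      by (rule add[OF mult[OF b(1) c(2)] mult[OF c(1) b(2)]])
    also have "g1 * b * c + g2 * c * b = (g1 + g2) * (b * c)" by (simp add: algebra_simps)
    also have "f1 * b' * c' + f2 * c' * b' = (f1 + f2) * (b' * c')"
      using comm[OF b(2) c(2)] by (simp add: algebra_simps)
    finally show ?thesis using b c by (intro QI[of _ "b * c" _ "b' * c'"]) (auto intro: mult)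
  qed
  have Q_uminus: "Q (- g) (- f)" if "Q g f" for g f
  proof -
    obtain b b' where b: "P (g * b) (f * b')" "P b b'" "b \<noteq> 0" "b' \<noteq> 0" using \<open>Q g f\<close> by (rule QE)
    show ?thesis using uminus[OF b(1)] b by (intro QI[of _ b _ b']) auto
  qed
  have Q_mult: "Q (g1 * g2) (f1 * f2)" if "Q g1 f1" "Q g2 f2" for g1 g2 f1 f2
  proof -
    obtain b b' where b: "P (g1 * b) (f1 * b')" "P b b'" "b \<noteq> 0" "b' \<noteq> 0" using \<open>Q g1 f1\<close> by (rule QE)
    obtain c c' where c: "P (g2 * c) (f2 * c')" "P c c'" "c \<noteq> 0" "c' \<noteq> 0" using \<open>Q g2 f2\<close> by (rule QE)
    \<comment> \<open>To collect the denominators, \<open>b'\<close> must commute with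
      \<open>f2\<close>, which need not lie in the image of \<open>P\<close>. It commutes with
      \<open>f2 * c'\<close> and with \<open>c'\<close>, and \<open>c'\<close> can be
      cancelled.\<close>
    have "b' * f2 * c' = f2 * c' * b'"
      using comm[OF b(2) c(1)] by (simp add: mult.assoc)
    also have "\<dots> = f2 * b' * c'"
      using comm[OF b(2) c(2)] by (simp add: mult.assoc)
    finally have bf: "b' * f2 = f2 * b'" using c by simp
    have "P (g1 * b * (g2 * c)) (f1 * b' * (f2 * c'))"
      by (rule mult[OF b(1) c(1)])
    also have "g1 * b * (g2 * c) = g1 * g2 * (b * c)" by (simp add: algebra_simps)
    also have "f1 * b' * (f2 * c') = f1 * f2 * (b' * c')"
      using bf by (metis mult.assoc)
    finally show ?thesis using b c by (intro QI[of _ "b * c" _ "b' * c'"]) (auto intro: mult)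
  qed
  have Q_zero: "g = 0 \<longleftrightarrow> f = 0" if "Q g f" for g f
  proof -
    obtain b b' where b: "P (g * b) (f * b')" "P b b'" "b \<noteq> 0" "b' \<noteq> 0" using \<open>Q g f\<close> by (rule QE)
    then show ?thesis using zero[OF b(1)] by simp
  qed
  have Q_inverse: "Q (inverse g) (inverse f)" if "Q g f" "g \<noteq> 0" for g f
  proof -
    obtain b b' where b: "P (g * b) (f * b')" "P b b'" "b \<noteq> 0" "b' \<noteq> 0" using \<open>Q g f\<close> by (rule QE)
    have "f \<noteq> 0" using Q_zero[OF \<open>Q g f\<close>] \<open>g \<noteq> 0\<close> by simp
    show ?thesis
    \<comment> \<open>Numerator and denominator exchange roles: the denominator of the inverse is
      the old numerator \<open>g * b\<close>.\<close>
    proof (rule QI)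
      show "P (g * b) (f * b')" by fact
      have "inverse g * (g * b) = b" "inverse f * (f * b') = b'"
        using \<open>g \<noteq> 0\<close> \<open>f \<noteq> 0\<close> by (simp_all only: mult.assoc[symmetric]) simp_all
      then show "P (inverse g * (g * b)) (inverse f * (f * b'))"
        using b by (simp only:)
    qed (use b \<open>g \<noteq> 0\<close> in simp)
  qed
  have Q_ex: "\<exists>f. Q g f" for g
  proof -
    have "g \<in> generate_field ring_of_type_algebra G" by (simp add: gen)
    then show ?thesis
    proof induction
      case one
      show ?case using Q_P[OF \<open>P 1 1\<close>] by auto
    next
      case (incl h)
      then show ?case using G Q_P by blast
    next
      case (a_inv h)
      then obtain f where "Q h f" by blast
      from Q_uminus[OF this] show ?case by auto
    next
      case (m_inv h)
      then obtain f where "Q h f" by blast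
      from Q_inverse[OF this] m_inv(2) show ?case by auto
    next
      case (eng_add h1 h2)
      then obtain f1 f2 where "Q h1 f1" "Q h2 f2" by blast
      from Q_add[OF this] show ?case by auto
    next
      case (eng_mult h1 h2)
      then obtain f1 f2 where "Q h1 f1" "Q h2 f2" by blast
      from Q_mult[OF this] show ?case by auto
    qed
  qed
  \<comment> \<open>Subtracting two pairs with a common component gives a pair with a zero
    component, so \<open>Q_zero\<close> yields both uniqueness and injectivity.\<close>
  have Q_fun: "f1 = f2" if "Q g f1" "Q g f2" for g f1 f2
    using Q_zero[OF Q_add[OF that(1) Q_uminus[OF that(2)]]] by simp
  have Q_inj: "g1 = g2" if "Q g1 f" "Q g2 f" for g1 g2 f
    using Q_zero[OF Q_add[OF that(1) Q_uminus[OF that(2)]]] by simp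
  define \<psi> where "\<psi> g = (SOME f. Q g f)" for g
  have Q\<psi>: "Q g (\<psi> g)" for g
    unfolding \<psi>_def by (rule someI_ex[OF Q_ex])
  show thesis
  proof
    show "\<psi> 1 = 1" using Q_fun[OF Q\<psi> Q_P[OF one]] .
    show "\<psi> (a + b) = \<psi> a + \<psi> b" for a b using Q_fun[OF Q\<psi> Q_add[OF Q\<psi> Q\<psi>]] .
    show "\<psi> (a * b) = \<psi> a * \<psi> b" for a b using Q_fun[OF Q\<psi> Q_mult[OF Q\<psi> Q\<psi>]] .
    show "inj \<psi>" by (rule injI) (metis Q\<psi> Q_inj)
    show "\<psi> a = a'" if "P a a'" for a a' using Q_fun[OF Q\<psi> Q_P[OF that]] .
  qed
qed

section \<open>Polynomials as finitely supported functions\<close>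

text \<open>The exponent type and the family \<open>y\<close> are arbitrary, so that one notion
  covers ordinary monomials as well as toric frames with integer exponents.\<close>

definition poly_eval :: "('a::zero \<Rightarrow> 'b::ring_1) \<Rightarrow> ('e \<Rightarrow> 'b) \<Rightarrow> ('e \<Rightarrow>\<^sub>0 'a) \<Rightarrow> 'b"
  where "poly_eval h y p = (\<Sum>m\<in>Poly_Mapping.keys p. h (Poly_Mapping.lookup p m) * y m)"

lemma frame_map_eq_poly_eval: "frame_map h M = poly_eval h M"
  by (simp add: fun_eq_iff frame_map_def poly_eval_def)

definition polys_over :: "'a::zero set \<Rightarrow> ('e \<Rightarrow>\<^sub>0 'a) set"
  where "polys_over R = {p. range (Poly_Mapping.lookup p) \<subseteq> R}"

lemma polys_overI: "(\<And>m. Poly_Mapping.lookup p m \<in> R) \<Longrightarrow> p \<in> polys_over R"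
  and polys_overD: "p \<in> polys_over R \<Longrightarrow> Poly_Mapping.lookup p m \<in> R"
  by (auto simp: polys_over_def)

context algebra_map
begin

lemma single_polys_over: "a \<in> R \<Longrightarrow> Poly_Mapping.single m a \<in> polys_over R"
  by (auto intro!: polys_overI simp: lookup_single when_def zero_closed)

lemma add_polys_over: "p \<in> polys_over R \<Longrightarrow> q \<in> polys_over R \<Longrightarrow> p + q \<in> polys_over R"
  by (auto intro!: polys_overI add_closed dest: polys_overD simp: lookup_add)

lemma uminus_polys_over: "p \<in> polys_over R \<Longrightarrow> - p \<in> polys_over R"
  by (auto intro!: polys_overI uminus_closed dest: polys_overD)

lemma zero_polys_over: "0 \<in> polys_over R"
  by (auto intro!: polys_overI zero_closed)

lemma sum_polys_over: "(\<And>s. s \<in> S \<Longrightarrow> p s \<in> polys_over R) \<Longrightarrow> sum p S \<in> polys_over R"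
  by (induction S rule: infinite_finite_induct)
     (auto intro: add_polys_over zero_polys_over)

lemma poly_eval_superset:
  assumes "finite A" "Poly_Mapping.keys p \<subseteq> A"
  shows "poly_eval h y p = (\<Sum>m\<in>A. h (Poly_Mapping.lookup p m) * y m)"
  unfolding poly_eval_def
  by (rule sum.mono_neutral_left) (use assms in \<open>auto simp: in_keys_iff map_zero\<close>)

lemma poly_eval_zero: "poly_eval h y 0 = 0"
  by (simp add: poly_eval_def)

lemma poly_eval_single: "poly_eval h y (Poly_Mapping.single m a) = h a * y m"
  by (simp add: poly_eval_def map_zero)

lemma poly_eval_add:
  assumes "p \<in> polys_over R" "q \<in> polys_over R"
  shows "poly_eval h y (p + q) = poly_eval h y p + poly_eval h y q"
proof -
  let ?A = "Poly_Mapping.keys p \<union> Poly_Mapping.keys q"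
  have "poly_eval h y (p + q) = (\<Sum>m\<in>?A. h (Poly_Mapping.lookup (p + q) m) * y m)"
    by (intro poly_eval_superset) (auto dest: subsetD[OF Poly_Mapping.keys_add])
  also have "\<dots> = (\<Sum>m\<in>?A. h (Poly_Mapping.lookup p m) * y m) + (\<Sum>m\<in>?A. h (Poly_Mapping.lookup q m) * y m)"
    using assms by (simp add: lookup_add map_add polys_overD distrib_right sum.distrib)
  finally show ?thesis using poly_eval_superset[of ?A] by simp
qed

lemma poly_eval_uminus:
  assumes "p \<in> polys_over R"
  shows "poly_eval h y (- p) = - poly_eval h y p"
  using poly_eval_add[OF assms uminus_polys_over[OF assms], of y]
  by (simp add: poly_eval_zero eq_neg_iff_add_eq_0 add.commute)

lemma poly_eval_sum:
  "(\<And>s. s \<in> S \<Longrightarrow> p s \<in> polys_over R) \<Longrightarrow> poly_eval h y (sum p S) = (\<Sum>s\<in>S. poly_eval h y (p s))"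
  by (induction S rule: infinite_finite_induct)
     (auto simp: poly_eval_zero poly_eval_add sum_polys_over)

lemma poly_eval_sum_single:
  "(\<And>s. s \<in> S \<Longrightarrow> a s \<in> R) \<Longrightarrow>
    poly_eval h y (\<Sum>s\<in>S. Poly_Mapping.single (e s) (a s)) = (\<Sum>s\<in>S. h (a s) * y (e s))"
  by (simp add: poly_eval_sum single_polys_over poly_eval_single)

end

text \<open>Used to recover the coefficients of a polynomial after its exponents have been renamed
  injectively.\<close>

lemma lookup_sum_single:
  assumes "inj_on e S" "finite S" "s \<in> S"
  shows "Poly_Mapping.lookup (\<Sum>s\<in>S. Poly_Mapping.single (e s) (a s)) (e s) = a s"
proof -
  have "Poly_Mapping.lookup (\<Sum>s\<in>S. Poly_Mapping.single (e s) (a s)) (e s)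
      = (\<Sum>t\<in>S. if t = s then a s else 0)"
    unfolding lookup_sum lookup_single when_def
    by (rule sum.cong) (use assms in \<open>auto simp: inj_on_eq_iff\<close>)
  then show ?thesis using assms by simp
qed

text \<open>This is the commutative product, without the twist of \<open>torus_mult\<close>; it is
  applied to exponents on which the evaluated monomials are strictly multiplicative.\<close>

definition convolution :: "('e::plus \<Rightarrow>\<^sub>0 'a::comm_ring_1) \<Rightarrow> ('e \<Rightarrow>\<^sub>0 'a) \<Rightarrow> ('e \<Rightarrow>\<^sub>0 'a)"
  where "convolution p q = (\<Sum>(f, g)\<in>Poly_Mapping.keys p \<times> Poly_Mapping.keys q.
    Poly_Mapping.single (f + g) (Poly_Mapping.lookup p f * Poly_Mapping.lookup q g))"

context algebra_map
begin

lemma convolution_polys_over: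
  "p \<in> polys_over R \<Longrightarrow> q \<in> polys_over R \<Longrightarrow> convolution p q \<in> polys_over R"
  unfolding convolution_def
  by (auto intro!: sum_polys_over single_polys_over mult_closed dest: polys_overD)

lemma poly_eval_convolution:
  fixes y :: "'e::plus \<Rightarrow> 'b"
  assumes "p \<in> polys_over R" "q \<in> polys_over R" and y: "\<And>f g. y (f + g) = y f * y g"
  shows "poly_eval h y (convolution p q) = poly_eval h y p * poly_eval h y q"
proof -
  have "poly_eval h y (convolution p q) = (\<Sum>(f, g)\<in>Poly_Mapping.keys p \<times> Poly_Mapping.keys q.
      h (Poly_Mapping.lookup p f * Poly_Mapping.lookup q g) * (y f * y g))"
    unfolding convolution_def split_def y[symmetric]
    by (rule poly_eval_sum_single) (rule mult_closed[OF polys_overD[OF assms(1)] polys_overD[OF assms(2)]])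
  also have "\<dots> = (\<Sum>(f, g)\<in>Poly_Mapping.keys p \<times> Poly_Mapping.keys q.
      (h (Poly_Mapping.lookup p f) * y f) * (h (Poly_Mapping.lookup q g) * y g))"
    unfolding split_def
  proof (rule sum.cong[OF refl])
    fix x :: "'e \<times> 'e"
    obtain f g where x: "x = (f, g)" by fastforce
    have p: "Poly_Mapping.lookup p f \<in> R" and q: "Poly_Mapping.lookup q g \<in> R"
      by (rule polys_overD[OF assms(1)], rule polys_overD[OF assms(2)])
    have "h (Poly_Mapping.lookup p f * Poly_Mapping.lookup q g) * (y f * y g)
        = h (Poly_Mapping.lookup p f) * (h (Poly_Mapping.lookup q g) * y f) * y g"
      by (simp only: map_mult[OF p q] mult.assoc)
    then show "h (Poly_Mapping.lookup p (fst x) * Poly_Mapping.lookup q (snd x)) * (y (fst x) * y (snd x))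
        = h (Poly_Mapping.lookup p (fst x)) * y (fst x) * (h (Poly_Mapping.lookup q (snd x)) * y (snd x))"
      by (simp only: x fst_conv snd_conv map_central[OF q, of "y f"] mult.assoc)
  qed
  also have "\<dots> = poly_eval h y p * poly_eval h y q"
    by (simp add: poly_eval_def sum_product sum.cartesian_product)
  finally show ?thesis .
qed

end

text \<open>Evaluating one polynomial on both sides gives a relation to which
  \<open>fraction_extension\<close> applies. The two independence hypotheses say that either value
  vanishes only for the zero polynomial, which is the zero condition required there.\<close>

lemma polynomial_embedding:
  fixes \<kappa> :: "'a::comm_ring_1 \<Rightarrow> 'g::field" and \<iota> :: "'a \<Rightarrow> 'f::division_ring"
    and y :: "'e::comm_monoid_add \<Rightarrow> 'g"
  assumes \<kappa>: "algebra_map R \<kappa>" and \<iota>: "algebra_map R \<iota>"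
    and y: "y 0 = 1" "\<And>m n. y (m + n) = y m * y n"
    and Y: "Y 0 = 1" "\<And>m n. Y (m + n) = Y m * Y n"
    and y0: "\<And>p. p \<in> polys_over R \<Longrightarrow> poly_eval \<kappa> y p = 0 \<Longrightarrow> p = 0"
    and Y0: "\<And>p. p \<in> polys_over R \<Longrightarrow> poly_eval \<iota> Y p = 0 \<Longrightarrow> p = 0"
    and gen: "generate_field ring_of_type_algebra (fraction_subfield R \<kappa> \<union> G) = UNIV"
    and G: "G \<subseteq> range y"
  obtains \<psi> where "\<psi> 1 = 1" "\<And>a b. \<psi> (a + b) = \<psi> a + \<psi> b" "\<And>a b. \<psi> (a * b) = \<psi> a * \<psi> b"
    "inj \<psi>" "\<And>a. a \<in> R \<Longrightarrow> \<psi> (\<kappa> a) = \<iota> a" "\<And>m. \<psi> (y m) = Y m"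
proof -
  interpret k: algebra_map R \<kappa> by fact
  interpret i: algebra_map R \<iota> by fact
  define P where "P g f \<longleftrightarrow> (\<exists>p\<in>polys_over R. g = poly_eval \<kappa> y p \<and> f = poly_eval \<iota> Y p)" for g f
  have PI: "P (poly_eval \<kappa> y p) (poly_eval \<iota> Y p)" if "p \<in> polys_over R" for p
    using that P_def by blast
  have P_coeff: "P (\<kappa> a) (\<iota> a)" if "a \<in> R" for a
    using PI[OF k.single_polys_over[OF that, of 0]] by (simp add: k.poly_eval_single i.poly_eval_single y Y)
  have P_y: "P (y m) (Y m)" for m
    using PI[OF k.single_polys_over[OF k.one_closed, of m]]
    by (simp add: k.poly_eval_single i.poly_eval_single k.map_one i.map_one)
  \<comment> \<open>The fraction subfield is itself generated by the image of \<open>R\<close>, so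
    it can be replaced by that image among the generators.\<close>
  have gen': "generate_field ring_of_type_algebra (\<kappa> ` R \<union> G) = UNIV"
  proof -
    have sub: "fraction_subfield R \<kappa> \<subseteq> generate_field ring_of_type_algebra (\<kappa> ` R \<union> G)"
    proof
      fix a assume "a \<in> fraction_subfield R \<kappa>"
      then show "a \<in> generate_field ring_of_type_algebra (\<kappa> ` R \<union> G)"
        unfolding fraction_subfield_def
        by induction (blast intro: generate_field.intros)+
    qed
    have "a \<in> generate_field ring_of_type_algebra (\<kappa> ` R \<union> G)" for a
    proof -
      have "a \<in> generate_field ring_of_type_algebra (fraction_subfield R \<kappa> \<union> G)"
        by (simp add: gen)
      then show ?thesis
      proof induction
        case (incl a)
        then show ?case using sub by (blast intro: generate_field.incl)
      qed (blast intro: generate_field.intros)+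
    qed
    then show ?thesis by blast
  qed
  show thesis
  proof (rule fraction_extension[of P "\<kappa> ` R \<union> G"])
    show "P 1 1" using P_coeff[OF k.one_closed] by (simp add: k.map_one i.map_one)
    show "P (a + b) (a' + b')" if "P a a'" "P b b'" for a a' b b'
    proof -
      obtain p q where "p \<in> polys_over R" "q \<in> polys_over R" "a = poly_eval \<kappa> y p" "a' = poly_eval \<iota> Y p"
        "b = poly_eval \<kappa> y q" "b' = poly_eval \<iota> Y q" using \<open>P a a'\<close> \<open>P b b'\<close> P_def by blast
      then show ?thesis
        using PI[OF k.add_polys_over, of p q] by (simp add: k.poly_eval_add i.poly_eval_add)
    qed
    show "P (a * b) (a' * b')" if "P a a'" "P b b'" for a a' b b'
    proof -
      obtain p q where "p \<in> polys_over R" "q \<in> polys_over R" "a = poly_eval \<kappa> y p" "a' = poly_eval \<iota> Y p"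
        "b = poly_eval \<kappa> y q" "b' = poly_eval \<iota> Y q" using \<open>P a a'\<close> \<open>P b b'\<close> P_def by blast
      then show ?thesis
        using PI[OF k.convolution_polys_over, of p q]
        by (simp add: k.poly_eval_convolution i.poly_eval_convolution y Y)
    qed
    show "P (- a) (- a')" if "P a a'" for a a'
    proof -
      obtain p where "p \<in> polys_over R" "a = poly_eval \<kappa> y p" "a' = poly_eval \<iota> Y p"
        using \<open>P a a'\<close> P_def by blast
      then show ?thesis
        using PI[OF k.uminus_polys_over, of p] by (simp add: k.poly_eval_uminus i.poly_eval_uminus)
    qed
    show "a = 0 \<longleftrightarrow> a' = 0" if "P a a'" for a a'
    proof -
      obtain p where p: "p \<in> polys_over R" "a = poly_eval \<kappa> y p" "a' = poly_eval \<iota> Y p"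
        using \<open>P a a'\<close> P_def by blast
      have "a = 0 \<longleftrightarrow> p = 0" using y0[OF p(1)] p(2) k.poly_eval_zero[of y] by auto
      moreover have "a' = 0 \<longleftrightarrow> p = 0" using Y0[OF p(1)] p(3) i.poly_eval_zero[of Y] by auto
      ultimately show ?thesis by simp
    qed
    show "generate_field ring_of_type_algebra (\<kappa> ` R \<union> G) = UNIV" by fact
    show "\<exists>a'. P a a'" if "a \<in> \<kappa> ` R \<union> G" for a
      using that G P_coeff P_y by blast
  qed (use P_coeff P_y in \<open>blast intro: that\<close>)
qed

section \<open>Bicharacters and matrix mutation\<close>

lemma axis_component: "axis i c $ j = (if j = i then c else 0)"
  by (simp add: axis_def)

lemma bicharacter_add_left: "bicharacter \<Lambda> (f + f') g = bicharacter \<Lambda> f g + bicharacter \<Lambda> f' g"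
  by (simp add: bicharacter_def algebra_simps sum.distrib)

lemma bicharacter_add_right: "bicharacter \<Lambda> f (g + g') = bicharacter \<Lambda> f g + bicharacter \<Lambda> f g'"
  by (simp add: bicharacter_def algebra_simps sum.distrib)

lemma bicharacter_scale_left: "bicharacter \<Lambda> (c *s f) g = c * bicharacter \<Lambda> f g"
  by (simp add: bicharacter_def sum_distrib_left mult.assoc)

lemma bicharacter_scale_right: "bicharacter \<Lambda> f (c *s g) = c * bicharacter \<Lambda> f g"
  by (simp add: bicharacter_def sum_distrib_left mult_ac)

lemma bicharacter_0_left [simp]: "bicharacter \<Lambda> 0 g = 0"
  and bicharacter_0_right [simp]: "bicharacter \<Lambda> f 0 = 0"
  by (simp_all add: bicharacter_def)

lemma bicharacter_uminus_left: "bicharacter \<Lambda> (- f) g = - bicharacter \<Lambda> f g"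
  using bicharacter_add_left[of \<Lambda> "- f" f g] by simp

lemma bicharacter_diff_right: "bicharacter \<Lambda> f (g - g') = bicharacter \<Lambda> f g - bicharacter \<Lambda> f g'"
  using bicharacter_add_right[of \<Lambda> f "g - g'" g'] by simp

lemma bicharacter_diff_left: "bicharacter \<Lambda> (f - f') g = bicharacter \<Lambda> f g - bicharacter \<Lambda> f' g"
  using bicharacter_add_left[of \<Lambda> "f - f'" f' g] by simp

lemma bicharacter_sum_left: "bicharacter \<Lambda> (sum h S) g = (\<Sum>s\<in>S. bicharacter \<Lambda> (h s) g)"
  by (induction S rule: infinite_finite_induct) (simp_all add: bicharacter_add_left)

lemma bicharacter_sum_right: "bicharacter \<Lambda> f (sum h S) = (\<Sum>s\<in>S. bicharacter \<Lambda> f (h s))"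
  by (induction S rule: infinite_finite_induct) (simp_all add: bicharacter_add_right)

lemma bicharacter_expand_left: "bicharacter \<Lambda> f g = (\<Sum>i\<in>UNIV. f $ i * bicharacter \<Lambda> (unit_vec i) g)"
proof -
  have "bicharacter \<Lambda> f g = bicharacter \<Lambda> (\<Sum>i\<in>UNIV. f $ i *s unit_vec i) g"
    by (simp only: basis_expansion)
  then show ?thesis
    by (simp only: bicharacter_sum_left bicharacter_scale_left)
qed

lemma bicharacter_expand_right: "bicharacter \<Lambda> f g = (\<Sum>i\<in>UNIV. g $ i * bicharacter \<Lambda> f (unit_vec i))"
proof -
  have "bicharacter \<Lambda> f g = bicharacter \<Lambda> f (\<Sum>i\<in>UNIV. g $ i *s unit_vec i)"
    by (simp only: basis_expansion)
  then show ?thesis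
    by (simp only: bicharacter_sum_right bicharacter_scale_right)
qed

lemma bicharacter_unit_vec [simp]: "bicharacter \<Lambda> (unit_vec i) (unit_vec j) = \<Lambda> $ i $ j"
proof -
  have "bicharacter \<Lambda> (unit_vec i) (unit_vec j)
      = (\<Sum>a\<in>UNIV. \<Sum>b\<in>UNIV. if b = j then if a = i then \<Lambda> $ a $ b else 0 else 0)"
    unfolding bicharacter_def axis_def by (intro sum.cong refl) auto
  then show ?thesis by simp
qed

text \<open>Rewrites the entries of the compatibility condition as pairings with columns of
  \<open>B\<close>, to which bilinearity applies.\<close>

lemma transpose_mult_eq_bicharacter:
  fixes \<Lambda> B :: "int ^ 'n::finite ^ 'n"
  shows
  "(transpose \<Lambda> ** B) $ i $ j = bicharacter \<Lambda> (column j B) (unit_vec i)"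
proof -
  have "bicharacter \<Lambda> (column j B) (unit_vec i) = (\<Sum>m\<in>UNIV. B $ m $ j * \<Lambda> $ m $ i)"
    by (subst bicharacter_expand_left) (simp add: column_def)
  then show ?thesis
    by (simp add: matrix_matrix_mult_def transpose_def mult.commute)
qed

lemma bicharacter_skew:
  fixes \<Lambda> :: "int ^ 'n::finite ^ 'n"
  assumes "\<And>i j. [\<Lambda> $ j $ i = - \<Lambda> $ i $ j] (mod m)"
  shows "[bicharacter \<Lambda> g f = - bicharacter \<Lambda> f g] (mod m)"
proof -
  have "bicharacter \<Lambda> f g = (\<Sum>j\<in>UNIV. \<Sum>i\<in>UNIV. g $ j * \<Lambda> $ i $ j * f $ i)"
    unfolding bicharacter_def by (subst sum.swap) (simp add: mult_ac)
  then have "- bicharacter \<Lambda> f g = (\<Sum>j\<in>UNIV. \<Sum>i\<in>UNIV. g $ j * (- \<Lambda> $ i $ j) * f $ i)"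
    by (simp add: sum_negf)
  then show ?thesis
    unfolding bicharacter_def by (simp only:) (intro cong_sum cong_mult cong_refl assms)
qed

text \<open>Commutation relations in a frame see its matrix only through doubled values; oddness of
  \<open>l\<close> recovers the values themselves.\<close>

lemma cong_2_cancel_odd:
  assumes "odd l" "[2 * a = 2 * b] (mod int l)"
  shows "[a = b] (mod int l)"
  using assms cong_mult_lcancel[of 2 "int l" a b] by (simp add: coprime_commute)

lemma skew_symmetrized_diagonal:
  fixes B :: "int ^ 'n::finite ^ 'n"
  assumes "skew_symmetrized_by ex d B"
  shows "B $ k $ k = 0"
proof (cases "k \<in> ex")
  case True
  then have "d k * B $ k $ k = - (d k * B $ k $ k)" "d k > 0"
    using assms unfolding skew_symmetrized_by_def by blast+
  then show ?thesis by simp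
next
  case False
  then show ?thesis using assms unfolding skew_symmetrized_by_def by blast
qed

section \<open>Matrix mutation and the compatibility condition\<close>

text \<open>The first form fits the substitution with the nonnegative part of column
  \<open>k\<close>; the second records that the division is exact.\<close>

lemma mutation_term:
  fixes x y :: int
  shows "(\<bar>x\<bar> * y + x * \<bar>y\<bar>) div 2 = y * max x 0 + x * max (- y) 0"
    and "2 * ((\<bar>x\<bar> * y + x * \<bar>y\<bar>) div 2) = \<bar>x\<bar> * y + x * \<bar>y\<bar>"
  by (auto simp: abs_if max_def algebra_simps)

text \<open>Away from row and column \<open>k\<close>, the factors \<open>d i\<close> and
  \<open>d j\<close> are exchanged by way of \<open>d k\<close>; positivity lets them pass absolute
  values. The computation uses twice the correction term, to avoid \<open>div\<close>.\<close>

lemma skew_symmetrized_mutation: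
  fixes B :: "int ^ 'n::finite ^ 'n"
  assumes "skew_symmetrized_by ex d B" "k \<in> ex"
  shows "skew_symmetrized_by ex d (matrix_mutation k B)"
proof -
  have z: "B $ i $ j = 0" if "j \<notin> ex" for i j
    using assms that unfolding skew_symmetrized_by_def by blast
  have pos: "d j > 0" if "j \<in> ex" for j
    using assms that unfolding skew_symmetrized_by_def by blast
  have skew: "d i * B $ i $ j = - (d j * B $ j $ i)" if "i \<in> ex" "j \<in> ex" for i j
    using assms that unfolding skew_symmetrized_by_def by blast
  have "d i * matrix_mutation k B $ i $ j = - (d j * matrix_mutation k B $ j $ i)"
    if i: "i \<in> ex" and j: "j \<in> ex" for i j
  proof (cases "i = k \<or> j = k")
    case True
    then show ?thesis using skew[OF i j] by (auto simp: matrix_mutation_def)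
  next
    case False
    let ?m = "\<lambda>i j. \<bar>B $ i $ k\<bar> * B $ k $ j + B $ i $ k * \<bar>B $ k $ j\<bar>"
    have ik: "d i * B $ i $ k = - (d k * B $ k $ i)" and kj: "d k * B $ k $ j = - (d j * B $ j $ k)"
      by (rule skew[OF i assms(2)], rule skew[OF assms(2) j])
    have ik': "d i * \<bar>B $ i $ k\<bar> = d k * \<bar>B $ k $ i\<bar>"
      using arg_cong[OF ik, of abs] pos[OF i] pos[OF assms(2)] by (simp add: abs_mult)
    have kj': "d k * \<bar>B $ k $ j\<bar> = d j * \<bar>B $ j $ k\<bar>"
      using arg_cong[OF kj, of abs] pos[OF j] pos[OF assms(2)] by (simp add: abs_mult)
    have "d i * ?m i j = (d i * \<bar>B $ i $ k\<bar>) * B $ k $ j + (d i * B $ i $ k) * \<bar>B $ k $ j\<bar>"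
      by (simp add: algebra_simps)
    also have "\<dots> = \<bar>B $ k $ i\<bar> * (d k * B $ k $ j) - B $ k $ i * (d k * \<bar>B $ k $ j\<bar>)"
      by (simp only: ik ik') (simp add: algebra_simps)
    also have "\<dots> = - (d j * ?m j i)"
      by (simp only: kj kj') (simp add: algebra_simps)
    finally have *: "d i * (2 * (?m i j div 2)) = - (d j * (2 * (?m j i div 2)))"
      by (simp only: mutation_term(2))
    have "matrix_mutation k B $ i $ j = B $ i $ j + ?m i j div 2"
      "matrix_mutation k B $ j $ i = B $ j $ i + ?m j i div 2"
      using False by (simp_all add: matrix_mutation_def)
    then show ?thesis
      using * skew[OF i j] by (simp only: distrib_left mult.left_commute[of _ 2])
  qed
  moreover have "matrix_mutation k B $ i $ j = 0" if "j \<notin> ex" for i j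
    using z[OF that] assms(2) by (auto simp: matrix_mutation_def)
  ultimately show ?thesis
    using pos unfolding skew_symmetrized_by_def by blast
qed

text \<open>The linear map \<open>e\<^sub>i \<mapsto> e\<^sub>i\<close> for \<open>i \<noteq> k\<close>, \<open>e\<^sub>k \<mapsto> - e\<^sub>k + [b\<^sup>k]\<^sub>+\<close>, which pulls the matrix of a toric
  frame back to the matrix of its mutation at \<open>k\<close>.\<close>

definition mutation_substitution :: "'n::finite \<Rightarrow> int ^ 'n ^ 'n \<Rightarrow> int ^ 'n \<Rightarrow> int ^ 'n"
  where "mutation_substitution k B f = f + f $ k *s (nonneg_part (column k B) - 2 *s unit_vec k)"

lemma nonneg_part_nth [simp]: "nonneg_part (c :: int ^ 'n::finite) $ i = max (c $ i) 0"
  and nonpos_part_nth [simp]: "nonpos_part (c :: int ^ 'n::finite) $ i = min (c $ i) 0"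
  and column_nth [simp]: "column j (B :: int ^ 'n::finite ^ 'n) $ i = B $ i $ j"
  by (simp_all add: nonneg_part_def nonpos_part_def column_def)

lemma mutation_substitution_unit_vec:
  "mutation_substitution k B (unit_vec i) =
    (if i = k then - unit_vec k + nonneg_part (column k B) else unit_vec i)"
  by (auto simp: mutation_substitution_def vec_eq_iff axis_def)

text \<open>This is the column form of the factorization of matrix mutation into \<open>B\<close>
  and two elementary matrices: the substitution turns each new column into a combination of old
  ones.\<close>

lemma mutation_substitution_column:
  fixes B :: "int ^ 'n::finite ^ 'n"
  assumes "B $ k $ k = 0"
  shows "mutation_substitution k B (column j (matrix_mutation k B)) =
    (if j = k then - column k B else column j B + max (- B $ k $ j) 0 *s column k B)"
  using assms
  by (auto simp: mutation_substitution_def vec_eq_iff matrix_mutation_def mutation_term(1) axis_def;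
      simp add: algebra_simps)

lemma bicharacter_mutation_substitution:
  "bicharacter \<Lambda> (mutation_substitution k B f) g =
    (\<Sum>i\<in>UNIV. f $ i * bicharacter \<Lambda> (mutation_substitution k B (unit_vec i)) g)"
proof -
  let ?w = "bicharacter \<Lambda> (nonneg_part (column k B) - 2 *s unit_vec k) g"
  have "(\<Sum>i\<in>UNIV. f $ i * (unit_vec i $ k * ?w)) = (\<Sum>i\<in>UNIV. if i = k then f $ k * ?w else 0)"
    by (intro sum.cong) (auto simp: axis_def)
  then show ?thesis
    unfolding mutation_substitution_def bicharacter_add_left bicharacter_scale_left
    by (subst bicharacter_expand_left[of _ f]) (simp add: distrib_left sum.distrib)
qed

text \<open>As \<Lambda>' is the pullback of \<Lambda> along the substitution, its pairing with a
  new column is a pairing of \<Lambda> with a combination of old columns, which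
  \<open>compat\<close> evaluates.\<close>

lemma compatible_mutation:
  fixes \<Lambda> \<Lambda>' B :: "int ^ 'n::finite ^ 'n"
  assumes skew: "skew_symmetrized_by ex d B" and k: "k \<in> ex"
    and compat: "\<And>j f. j \<in> ex \<Longrightarrow> [bicharacter \<Lambda> (column j B) f = d j * f $ j] (mod m)"
    and \<Lambda>': "\<And>i j. [\<Lambda>' $ i $ j = bicharacter \<Lambda> (mutation_substitution k B (unit_vec i))
      (mutation_substitution k B (unit_vec j))] (mod m)"
    and j: "j \<in> ex"
  shows "[(transpose \<Lambda>' ** matrix_mutation k B) $ i $ j = (if i = j then d j else 0)] (mod m)"
proof -
  have Bkk: "B $ k $ k = 0" using skew by (rule skew_symmetrized_diagonal)
  let ?\<phi> = "mutation_substitution k B" and ?B' = "matrix_mutation k B"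
  have "(transpose \<Lambda>' ** ?B') $ i $ j = (\<Sum>a\<in>UNIV. column j ?B' $ a * \<Lambda>' $ a $ i)"
    unfolding transpose_mult_eq_bicharacter by (subst bicharacter_expand_left) simp
  also have "[\<dots> = (\<Sum>a\<in>UNIV. column j ?B' $ a * bicharacter \<Lambda> (?\<phi> (unit_vec a)) (?\<phi> (unit_vec i)))] (mod m)"
    by (intro cong_sum cong_mult cong_refl \<Lambda>')
  also have "(\<Sum>a\<in>UNIV. column j ?B' $ a * bicharacter \<Lambda> (?\<phi> (unit_vec a)) (?\<phi> (unit_vec i)))
      = bicharacter \<Lambda> (?\<phi> (column j ?B')) (?\<phi> (unit_vec i))"
    by (rule bicharacter_mutation_substitution[symmetric])
  also have "[\<dots> = (if i = j then d j else 0)] (mod m)"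
  proof (cases "j = k")
    case True
    have "[- bicharacter \<Lambda> (column k B) (?\<phi> (unit_vec i)) = - (d k * ?\<phi> (unit_vec i) $ k)] (mod m)"
      using compat[OF k] by (simp add: cong_minus_minus_iff)
    \<comment> \<open>The coordinate at \<open>k\<close> of the substituted vector is -1 for
      \<open>i = k\<close>, since \<open>B $ k $ k = 0\<close>, and 0 otherwise.\<close>
    moreover have "- (d k * ?\<phi> (unit_vec i) $ k) = (if i = j then d j else 0)"
      using True Bkk by (auto simp: mutation_substitution_unit_vec axis_component)
    ultimately show ?thesis
      using True by (simp add: mutation_substitution_column[OF Bkk] bicharacter_uminus_left)
  next
    case False
    let ?t = "max (- B $ k $ j) 0"
    have "[bicharacter \<Lambda> (column j B) (?\<phi> (unit_vec i)) + ?t * bicharacter \<Lambda> (column k B) (?\<phi> (unit_vec i))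
        = d j * ?\<phi> (unit_vec i) $ j + ?t * (d k * ?\<phi> (unit_vec i) $ k)] (mod m)"
      by (intro cong_add cong_mult cong_refl compat j k)
    moreover have "d j * ?\<phi> (unit_vec i) $ j + ?t * (d k * ?\<phi> (unit_vec i) $ k) = (if i = j then d j else 0)"
    proof (cases "i = k")
      case True
      \<comment> \<open>For \<open>i = k\<close> the substituted vector has coordinate
        \<open>max (B $ j $ k) 0\<close> at \<open>j\<close> and -1 at \<open>k\<close>. The two
        contributions cancel by skew-symmetrizability.\<close>
      have s: "d j * B $ j $ k = - (d k * B $ k $ j)" and pos: "d j > 0" "d k > 0"
        using skew j k unfolding skew_symmetrized_by_def by blast+
      have "d j * max (B $ j $ k) 0 = max (d j * B $ j $ k) 0"
        using pos by (simp add: max_mult_distrib_left)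
      also have "\<dots> = d k * ?t"
        using pos unfolding s by (simp add: max_mult_distrib_left)
      finally show ?thesis
        using False True Bkk by (auto simp: mutation_substitution_unit_vec axis_component algebra_simps)
    qed (use False in \<open>auto simp: mutation_substitution_unit_vec axis_component\<close>)
    ultimately show ?thesis
      using False by (simp add: mutation_substitution_column[OF Bkk] bicharacter_add_left bicharacter_scale_left)
  qed
  finally show ?thesis .
qed

section \<open>Root of unity toric frames\<close>

lemma base_ring_closed:
  shows "1 \<in> base_ring" "a \<in> base_ring \<Longrightarrow> b \<in> base_ring \<Longrightarrow> a + b \<in> base_ring"
    "a \<in> base_ring \<Longrightarrow> b \<in> base_ring \<Longrightarrow> a * b \<in> base_ring" "a \<in> base_ring \<Longrightarrow> - a \<in> base_ring"
  unfolding base_ring_def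
  by (metis rangeI to_ac_1 to_fract_1)
     (auto simp flip: to_ac_add to_fract_add to_ac_mult to_fract_mult to_ac_minus to_fract_uminus)

lemma cyclotomic_ring_closed:
  shows "1 \<in> cyclotomic_ring \<zeta>"
    "a \<in> cyclotomic_ring \<zeta> \<Longrightarrow> b \<in> cyclotomic_ring \<zeta> \<Longrightarrow> a + b \<in> cyclotomic_ring \<zeta>"
    "a \<in> cyclotomic_ring \<zeta> \<Longrightarrow> b \<in> cyclotomic_ring \<zeta> \<Longrightarrow> a * b \<in> cyclotomic_ring \<zeta>"
    "a \<in> cyclotomic_ring \<zeta> \<Longrightarrow> - a \<in> cyclotomic_ring \<zeta>"
  unfolding cyclotomic_ring_def
  using generate_ring.one[of ring_of_type_algebra] generate_ring.eng_add[of _ ring_of_type_algebra]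
    generate_ring.eng_mult[of _ ring_of_type_algebra] generate_ring.a_inv[of _ ring_of_type_algebra]
  by (simp_all only: ring_of_type_algebra_simps a_inv_ring_of_type_algebra)

lemma base_ring_subset_cyclotomic_ring: "base_ring \<subseteq> cyclotomic_ring \<zeta>"
  and root_mem_cyclotomic_ring: "\<zeta> \<in> cyclotomic_ring \<zeta>"
  unfolding cyclotomic_ring_def by (auto intro: generate_ring.incl)

lemma primitive_root_powi_eq_1_iff:
  assumes "primitive_root_of_unity l \<zeta>"
  shows "\<zeta> powi a = 1 \<longleftrightarrow> int l dvd a"
proof -
  have l: "l > 0" and z: "\<zeta> ^ l = 1" and min: "\<And>m. 0 < m \<Longrightarrow> m < l \<Longrightarrow> \<zeta> ^ m \<noteq> 1"
    using assms by (auto simp: primitive_root_of_unity_def)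
  have z0: "\<zeta> \<noteq> 0" using z l by (cases "\<zeta> = 0") (auto simp: power_0_left)
  define r where "r = nat (a mod int l)"
  have r: "int r = a mod int l" "r < l"
    using l by (simp_all add: r_def nat_less_iff)
  have "\<zeta> powi a = \<zeta> powi (int l * (a div int l) + int r)" using r(1) by simp
  also have "\<dots> = (\<zeta> powi int l) powi (a div int l) * \<zeta> ^ r"
    using z0 by (simp add: power_int_add power_int_mult)
  finally have "\<zeta> powi a = \<zeta> ^ r" using z by simp
  moreover have "\<zeta> ^ r = 1 \<longleftrightarrow> r = 0" using min[of r] r(2) by (cases "r = 0") auto
  moreover have "r = 0 \<longleftrightarrow> int l dvd a" using r(1) by (metis dvd_eq_mod_eq_0 of_nat_eq_0_iff)
  ultimately show ?thesis by simp
qed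

lemma primitive_root_powi_eq_iff:
  assumes "primitive_root_of_unity l \<zeta>"
  shows "\<zeta> powi a = \<zeta> powi b \<longleftrightarrow> [a = b] (mod int l)"
proof -
  have "\<zeta> \<noteq> 0" using assms by (cases "\<zeta> = 0") (auto simp: primitive_root_of_unity_def power_0_left)
  then have "\<zeta> powi a = \<zeta> powi b \<longleftrightarrow> \<zeta> powi (a - b) = 1"
    by (simp add: power_int_diff)
  then show ?thesis
    using primitive_root_powi_eq_1_iff[OF assms] by (simp add: cong_iff_dvd_diff)
qed

lemma primitive_root_powi:
  assumes "primitive_root_of_unity l \<zeta>" "coprime (int l) n"
  shows "primitive_root_of_unity l (\<zeta> powi n)"
proof -
  have *: "(\<zeta> powi n) ^ m = 1 \<longleftrightarrow> l dvd m" for m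
  proof -
    have "(\<zeta> powi n) ^ m = \<zeta> powi (n * int m)" by (simp add: power_int_power')
    then show ?thesis
      using primitive_root_powi_eq_1_iff[OF assms(1), of "n * int m"] coprime_dvd_mult_right_iff[OF assms(2)] by simp
  qed
  then show ?thesis using assms(1) by (auto simp: primitive_root_of_unity_def dest: dvd_imp_le)
qed

locale root_of_unity =
  fixes l :: nat and \<zeta> :: "'k::idom fract alg_closure"
    and \<iota> :: "'k fract alg_closure \<Rightarrow> 'f::division_ring"
  assumes primitive: "primitive_root_of_unity l \<zeta>"
    and algebra: "algebra_structure (cyclotomic_ring \<zeta>) \<iota>"
    and odd: "odd l"

sublocale root_of_unity \<subseteq> algebra_map "cyclotomic_ring \<zeta>" \<iota>
  by (rule algebra_mapI[OF algebra]) (fact cyclotomic_ring_closed)+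

context root_of_unity
begin

text \<open>In the usual notation this is the power of \<epsilon> with exponent \<open>n/2\<close>,
  so bicharacter values enter without being halved.\<close>

definition q :: "int \<Rightarrow> 'f" where "q n = \<iota> (\<zeta> powi n)"

text \<open>Negative powers lie in the ring because exponents can be reduced modulo \<open>l\<close>
  to natural numbers.\<close>

lemma powi_closed: "\<zeta> powi n \<in> cyclotomic_ring \<zeta>"
proof -
  have "l > 0" using primitive by (simp add: primitive_root_of_unity_def)
  then have "int (nat (n mod int l)) = n mod int l" by simp
  moreover have "\<zeta> powi n = \<zeta> powi (n mod int l)"
    unfolding primitive_root_powi_eq_iff[OF primitive] by (simp add: cong_def)
  ultimately have "\<zeta> powi n = \<zeta> ^ nat (n mod int l)"
    by (metis power_int_of_nat)
  then show ?thesis by (simp add: power_closed root_mem_cyclotomic_ring)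
qed

lemma root_nonzero: "\<zeta> \<noteq> 0"
  using primitive by (cases "\<zeta> = 0") (auto simp: primitive_root_of_unity_def power_0_left)

lemma q_add: "q (a + b) = q a * q b"
  using root_nonzero by (simp add: q_def power_int_add map_mult[OF powi_closed powi_closed])

lemma q_0 [simp]: "q 0 = 1"
  by (simp add: q_def map_one)

lemma q_cong: "[a = b] (mod int l) \<Longrightarrow> q a = q b"
  by (simp add: q_def flip: primitive_root_powi_eq_iff[OF primitive])

end

section \<open>Computing in a toric frame\<close>

locale root_of_unity_frame = root_of_unity l \<zeta> \<iota>
  for l :: nat and \<zeta> :: "'k::idom fract alg_closure"
    and \<iota> :: "'k fract alg_closure \<Rightarrow> 'f::division_ring" +
  fixes \<Lambda> :: "int ^ 'n::finite ^ 'n" and M :: "int ^ 'n \<Rightarrow> 'f"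
  assumes frame: "toric_frame_with_matrix l \<zeta> \<iota> \<Lambda> M"
begin

lemma carrier_quantum_torus: "carrier (quantum_torus \<zeta> \<Lambda>) = polys_over (cyclotomic_ring \<zeta>)"
  by (simp add: quantum_torus_def polys_over_def)

lemma frame_hom: "frame_map \<iota> M \<in> ring_hom (quantum_torus \<zeta> \<Lambda>) ring_of_type_algebra"
  and frame_inj: "inj_on (poly_eval \<iota> M) (polys_over (cyclotomic_ring \<zeta>))"
  and skew: "[\<Lambda> $ j $ i = - \<Lambda> $ i $ j] (mod int l)"
  using frame unfolding toric_frame_with_matrix_def carrier_quantum_torus frame_map_eq_poly_eval by blast+

lemma frame_independent:
  assumes "p \<in> polys_over (cyclotomic_ring \<zeta>)" "poly_eval \<iota> M p = 0"
  shows "p = 0"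
  using inj_onD[OF frame_inj, of p 0] assms zero_polys_over poly_eval_zero[of M] by simp

lemma frame_zero: "M 0 = 1"
proof -
  have "frame_map \<iota> M (Poly_Mapping.single 0 1) = 1"
    using frame_hom by (auto simp: ring_hom_def quantum_torus_def)
  then show ?thesis
    by (simp only: frame_map_eq_poly_eval poly_eval_single map_one mult_1)
qed

text \<open>Coefficients are compared as constants of the quantum torus, that is, at exponent
  0.\<close>

lemma coefficient_inj: "inj_on \<iota> (cyclotomic_ring \<zeta>)"
proof (rule inj_onI)
  fix a b assume ab: "a \<in> cyclotomic_ring \<zeta>" "b \<in> cyclotomic_ring \<zeta>" "\<iota> a = \<iota> b"
  have "poly_eval \<iota> M (Poly_Mapping.single 0 a) = poly_eval \<iota> M (Poly_Mapping.single 0 b)"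
    by (simp only: poly_eval_single ab(3))
  then have "Poly_Mapping.single (0 :: int ^ 'n) a = Poly_Mapping.single 0 b"
    by (rule inj_onD[OF frame_inj _ single_polys_over[OF ab(1)] single_polys_over[OF ab(2)]])
  then show "a = b" by (metis lookup_single_eq)
qed

lemma q_eq_iff: "q a = q b \<longleftrightarrow> [a = b] (mod int l)"
  using inj_on_eq_iff[OF coefficient_inj powi_closed powi_closed]
  by (simp add: q_def primitive_root_powi_eq_iff[OF primitive])

lemma frame_mult: "M f * M g = q (bicharacter \<Lambda> f g) * M (f + g)"
proof -
  let ?s = "\<lambda>f. Poly_Mapping.single f (1 :: 'k fract alg_closure)"
  have "?s f \<in> carrier (quantum_torus \<zeta> \<Lambda>)" for f :: "int ^ 'n"
    unfolding carrier_quantum_torus by (intro single_polys_over one_closed)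
  with frame_hom have "frame_map \<iota> M (torus_mult \<zeta> \<Lambda> (?s f) (?s g)) = frame_map \<iota> M (?s f) * frame_map \<iota> M (?s g)"
    by (auto simp: ring_hom_def quantum_torus_def)
  moreover have "torus_mult \<zeta> \<Lambda> (?s f) (?s g) = Poly_Mapping.single (f + g) (\<zeta> powi bicharacter \<Lambda> f g)"
    by (simp add: torus_mult_def)
  ultimately show ?thesis
    by (simp add: frame_map_eq_poly_eval poly_eval_single map_one q_def)
qed

text \<open>The product of \<open>M f\<close> and \<open>M (- f)\<close> is a unit multiple of
  \<open>M 0 = 1\<close>.\<close>

lemma frame_nonzero: "M f \<noteq> 0"
proof
  assume "M f = 0"
  then have "q (bicharacter \<Lambda> f (- f)) * M 0 = 0" using frame_mult[of f "- f"] by simp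
  moreover have "q (bicharacter \<Lambda> f (- f)) * q (- bicharacter \<Lambda> f (- f)) = 1"
    using q_add[of "bicharacter \<Lambda> f (- f)" "- bicharacter \<Lambda> f (- f)"] by simp
  ultimately show False by (auto simp: frame_zero)
qed

lemma bicharacter_self: "[bicharacter \<Lambda> f f = 0] (mod int l)"
proof (rule cong_2_cancel_odd[OF odd])
  have "[bicharacter \<Lambda> f f + bicharacter \<Lambda> f f = - bicharacter \<Lambda> f f + bicharacter \<Lambda> f f] (mod int l)"
    by (intro cong_add bicharacter_skew skew cong_refl)
  then show "[2 * bicharacter \<Lambda> f f = 2 * 0] (mod int l)" by simp
qed

lemma frame_commute: "M f * M g = q (2 * bicharacter \<Lambda> f g) * (M g * M f)"
proof -
  have "[2 * bicharacter \<Lambda> f g + bicharacter \<Lambda> g f = 2 * bicharacter \<Lambda> f g + - bicharacter \<Lambda> f g] (mod int l)"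
    by (intro cong_add bicharacter_skew skew cong_refl)
  then have "q (2 * bicharacter \<Lambda> f g + bicharacter \<Lambda> g f) = q (bicharacter \<Lambda> f g)"
    by (intro q_cong) simp
  then show ?thesis
    by (simp only: frame_mult[of f g] frame_mult[of g f] q_add add.commute[of f g] flip: mult.assoc)
qed

text \<open>The twist between \<open>f\<close> and its multiples is trivial by
  \<open>bicharacter_self\<close>.\<close>

lemma frame_power: "M f ^ n = M (int n *s f)"
proof (induction n)
  case (Suc n)
  have "[bicharacter \<Lambda> f (int n *s f) = int n * 0] (mod int l)"
    unfolding bicharacter_scale_right by (intro cong_mult cong_refl bicharacter_self)
  then have "q (bicharacter \<Lambda> f (int n *s f)) = 1"
    using q_cong[of _ 0] by simp
  moreover have "f + int n *s f = int (Suc n) *s f"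
    by (simp add: vec_eq_iff algebra_simps)
  ultimately show ?case
    using Suc frame_mult[of f "int n *s f"] by simp
qed (simp add: frame_zero)

text \<open>The twist exponent is divisible by \<open>l\<close>. On exponents in \<open>l\<close>
  times the lattice the frame is thus strictly multiplicative, which makes the algebra of
  \<open>l\<close>-th powers an ordinary polynomial one.\<close>

lemma frame_scaled_add: "M (int l *s (f + g)) = M (int l *s f) * M (int l *s g)"
proof -
  have "[int l * bicharacter \<Lambda> f (int l *s g) = 0 * bicharacter \<Lambda> f (int l *s g)] (mod int l)"
    by (intro cong_mult cong_refl) (simp add: cong_def)
  then have "q (bicharacter \<Lambda> (int l *s f) (int l *s g)) = 1"
    unfolding bicharacter_scale_left using q_cong[of _ 0] by simp
  then show ?thesis
    using frame_mult[of "int l *s f" "int l *s g"] by (simp add: vector_add_ldistrib)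
qed

end

section \<open>One quantum mutation\<close>

context root_of_unity
begin

text \<open>The first conclusion allows the step to be repeated along a mutation sequence. The
  second is the classical exchange relation for \<open>l\<close>-th powers, with the old variable
  multiplied across.\<close>

lemma quantum_mutation_step:
  fixes M M' :: "int ^ 'n::finite \<Rightarrow> 'f"
  assumes seed: "is_quantum_seed l \<zeta> \<iota> ex d (M, B)"
    and mut: "quantum_mutation l \<zeta> \<iota> k (M, B) (M', B')"
    and k: "k \<in> ex" and coprime: "coprime (int l) (d k)"
  shows "is_quantum_seed l \<zeta> \<iota> ex d (M', B')"
    and "M' (unit_vec k) ^ l * M (unit_vec k) ^ l =
      M (int l *s nonneg_part (column k B)) + M (int l *s (- nonpos_part (column k B)))"
proof -
  obtain \<Lambda> where skewB: "skew_symmetrized_by ex d B"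
    and \<Lambda>: "toric_frame_with_matrix l \<zeta> \<iota> \<Lambda> M"
    and compat': "\<And>i j. j \<in> ex \<Longrightarrow> [(transpose \<Lambda> ** B) $ i $ j = (if i = j then d j else 0)] (mod int l)"
    using seed by (auto simp: is_quantum_seed_def)
  obtain \<Lambda>' where \<Lambda>': "toric_frame_with_matrix l \<zeta> \<iota> \<Lambda>' M'"
    and M'_other: "\<And>i. i \<noteq> k \<Longrightarrow> M' (unit_vec i) = M (unit_vec i)"
    and M'_k: "M' (unit_vec k) =
      M (- unit_vec k + nonneg_part (column k B)) + M (- unit_vec k - nonpos_part (column k B))"
    and B': "B' = matrix_mutation k B"
    using mut by (auto simp: quantum_mutation_def toric_frame_def)
  interpret F: root_of_unity_frame l \<zeta> \<iota> \<Lambda> M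
    by unfold_locales (fact \<Lambda>)
  interpret F': root_of_unity_frame l \<zeta> \<iota> \<Lambda>' M'
    by unfold_locales (fact \<Lambda>')
  have Bkk: "B $ k $ k = 0" using skewB by (rule skew_symmetrized_diagonal)
  let ?\<beta> = "bicharacter \<Lambda>" and ?b = "column k B" and ?\<phi> = "mutation_substitution k B"
  define f where "f = - unit_vec k + nonneg_part ?b"
  define g where "g = - unit_vec k - nonpos_part ?b"
  have M'_sum: "M' (unit_vec k) = M f + M g"
    by (simp only: M'_k f_def g_def)
  have fg: "f = g + ?b"
    by (auto simp: f_def g_def vec_eq_iff)
  have gf: "g = f - ?b" using fg by simp
  have \<phi>: "?\<phi> (unit_vec i) = (if i = k then f else unit_vec i)" for i
    by (simp add: mutation_substitution_unit_vec f_def)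
  have compat: "[?\<beta> (column j B) h = d j * h $ j] (mod int l)" if "j \<in> ex" for j h
  proof -
    have "[(\<Sum>i\<in>UNIV. h $ i * ?\<beta> (column j B) (unit_vec i))
        = (\<Sum>i\<in>UNIV. h $ i * (if i = j then d j else 0))] (mod int l)"
      using compat'[OF that] by (intro cong_sum cong_mult cong_refl) (simp add: transpose_mult_eq_bicharacter)
    also have "(\<Sum>i\<in>UNIV. h $ i * (if i = j then d j else 0)) = d j * h $ j"
      by (simp add: if_distrib mult.commute cong: if_cong)
    finally show ?thesis
      by (simp flip: bicharacter_expand_right)
  qed
  \<comment> \<open>Column \<open>k\<close> pairs trivially with the other unit vectors. As
    \<open>f\<close> and \<open>g\<close> differ by this column, both summands of
    \<open>M' (unit_vec k)\<close> have the same commutation factor with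
    \<open>M (unit_vec i)\<close>, and so does their sum.\<close>
  have b_other: "[?\<beta> ?b (unit_vec i) = 0] (mod int l)" if "i \<noteq> k" for i
    using compat[OF k, of "unit_vec i"] that by (simp add: axis_component)
  have b_other': "[?\<beta> (unit_vec i) ?b = 0] (mod int l)" if "i \<noteq> k" for i
    using cong_trans[OF bicharacter_skew[OF F.skew] cong_minus_minus_iff[THEN iffD2, OF b_other[OF that]]] by simp

  have comm_right: "M (unit_vec i) * M' (unit_vec k) = q (2 * ?\<beta> (unit_vec i) f) * (M' (unit_vec k) * M (unit_vec i))"
    if "i \<noteq> k" for i
  proof -
    have "[2 * (?\<beta> (unit_vec i) f - ?\<beta> (unit_vec i) ?b) = 2 * (?\<beta> (unit_vec i) f - 0)] (mod int l)"
      by (intro cong_mult cong_diff cong_refl b_other' that)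
    then have "q (2 * ?\<beta> (unit_vec i) g) = q (2 * ?\<beta> (unit_vec i) f)"
      by (intro q_cong) (simp add: gf bicharacter_diff_right)
    then show ?thesis
      using F.frame_commute[of "unit_vec i" f] F.frame_commute[of "unit_vec i" g]
      by (simp only: M'_sum distrib_left distrib_right)
  qed
  have comm_left: "M' (unit_vec k) * M (unit_vec i) = q (2 * ?\<beta> f (unit_vec i)) * (M (unit_vec i) * M' (unit_vec k))"
    if "i \<noteq> k" for i
  proof -
    have "[2 * (?\<beta> f (unit_vec i) - ?\<beta> ?b (unit_vec i)) = 2 * (?\<beta> f (unit_vec i) - 0)] (mod int l)"
      by (intro cong_mult cong_diff cong_refl b_other that)
    then have "q (2 * ?\<beta> g (unit_vec i)) = q (2 * ?\<beta> f (unit_vec i))"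
      by (intro q_cong) (simp add: gf bicharacter_diff_left)
    then show ?thesis
      using F.frame_commute[of f "unit_vec i"] F.frame_commute[of g "unit_vec i"]
      by (simp only: M'_sum distrib_left distrib_right)
  qed
  have comm: "M' (unit_vec i) * M' (unit_vec j) =
      q (2 * ?\<beta> (?\<phi> (unit_vec i)) (?\<phi> (unit_vec j))) * (M' (unit_vec j) * M' (unit_vec i))" for i j
  proof -
    have ff: "q (2 * ?\<beta> f f) = 1"
      using q_cong[OF cong_mult[OF cong_refl F.bicharacter_self], of 2 f] by simp
    consider "i = k" "j = k" | "i = k" "j \<noteq> k" | "i \<noteq> k" "j = k" | "i \<noteq> k" "j \<noteq> k" by blast
    then show ?thesis
    proof cases
      case 1
      then show ?thesis by (simp add: \<phi> ff)
    next
      case 2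
      then show ?thesis using comm_left[OF 2(2)] by (simp add: \<phi> M'_other)
    next
      case 3
      then show ?thesis using comm_right[OF 3(1)] by (simp add: \<phi> M'_other)
    next
      case 4
      then show ?thesis using F.frame_commute[of "unit_vec i" "unit_vec j"]
        by (simp only: \<phi> 4 if_False M'_other[OF 4(1)] M'_other[OF 4(2)])
    qed
  qed
  have \<Lambda>'_cong: "[\<Lambda>' $ i $ j = ?\<beta> (?\<phi> (unit_vec i)) (?\<phi> (unit_vec j))] (mod int l)" for i j
  proof -
    \<comment> \<open>The same products are compared by the commutation rule of the frame
      \<open>M'\<close> itself; the nonzero product is cancelled.\<close>
    have "q (2 * \<Lambda>' $ i $ j) = q (2 * ?\<beta> (?\<phi> (unit_vec i)) (?\<phi> (unit_vec j)))"
      using comm[of i j] F'.frame_commute[of "unit_vec i" "unit_vec j"]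
        F'.frame_nonzero[of "unit_vec i"] F'.frame_nonzero[of "unit_vec j"] by simp
    then show ?thesis
      unfolding F.q_eq_iff by (rule cong_2_cancel_odd[OF odd])
  qed
  show "is_quantum_seed l \<zeta> \<iota> ex d (M', B')"
    unfolding is_quantum_seed_def B'
    using skew_symmetrized_mutation[OF skewB k] \<Lambda>' compatible_mutation[OF skewB k compat \<Lambda>'_cong] by blast

  \<comment> \<open>Since \<open>f = g + ?b\<close>, the pairing of \<open>f\<close> with
    \<open>g\<close> splits into the compatibility value at \<open>g\<close>, whose coordinate at
    \<open>k\<close> is -1, and a vanishing self-pairing.\<close>
  have "[?\<beta> ?b g + ?\<beta> g g = d k * g $ k + 0] (mod int l)"
    by (intro cong_add compat k F.bicharacter_self)
  moreover have "g $ k = -1" by (simp add: g_def Bkk)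
  ultimately have "[?\<beta> f g = - d k] (mod int l)"
    by (simp add: fg bicharacter_add_left add.commute)
  then have "q (2 * ?\<beta> f g) = q (2 * - d k)"
    by (intro q_cong cong_mult cong_refl)
  then have "M f * M g = \<iota> (\<zeta> powi (2 * - d k)) * (M g * M f)"
    using F.frame_commute[of f g] by (simp add: q_def)
  moreover have "primitive_root_of_unity l (\<zeta> powi (2 * - d k))"
    using coprime odd by (intro primitive_root_powi[OF primitive]) (simp add: coprime_commute)
  ultimately have "(M f + M g) ^ l = M f ^ l + M g ^ l"
    by (intro primitive_root_power_add[OF algebra_map_axioms powi_closed])
  then have "M' (unit_vec k) ^ l = M (int l *s f) + M (int l *s g)"
    by (simp only: M'_sum F.frame_power)
  moreover have "M (unit_vec k) ^ l = M (int l *s unit_vec k)"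
    by (rule F.frame_power)
  \<comment> \<open>Adding \<open>unit_vec k\<close> removes the negative coordinate from both
    exponents and leaves those of the exchange monomials.\<close>
  ultimately have "M' (unit_vec k) ^ l * M (unit_vec k) ^ l
      = M (int l *s (f + unit_vec k)) + M (int l *s (g + unit_vec k))"
    by (simp add: F.frame_scaled_add distrib_right)
  then show "M' (unit_vec k) ^ l * M (unit_vec k) ^ l =
      M (int l *s nonneg_part (column k B)) + M (int l *s (- nonpos_part (column k B)))"
    by (simp add: f_def g_def)
qed

end

section \<open>Embedding the classical seeds\<close>

lemma monomials_independent:
  fixes x :: "'n::finite \<Rightarrow> 'g::field" and p :: "nat ^ 'n \<Rightarrow>\<^sub>0 'a::comm_ring_1"
  assumes \<kappa>: "algebra_map R \<kappa>" and inj: "inj_on \<kappa> R"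
    and indep: "algebraically_independent (fraction_subfield R \<kappa>) x"
    and p: "p \<in> polys_over R" and eval: "poly_eval \<kappa> (\<lambda>m. \<Prod>i\<in>UNIV. x i ^ (m $ i)) p = 0"
  shows "p = 0"
proof -
  interpret algebra_map R \<kappa> by fact
  define K where "K = fraction_subfield R \<kappa>"
  interpret K: algebra_map K "\<lambda>a. a"
  proof
    show "1 \<in> K"
      using generate_field.one[of ring_of_type_algebra] by (simp add: K_def fraction_subfield_def)
    show "a + b \<in> K" if "a \<in> K" "b \<in> K" for a b
      using generate_field.eng_add[of a ring_of_type_algebra _ b] that by (simp add: K_def fraction_subfield_def)
    show "a * b \<in> K" if "a \<in> K" "b \<in> K" for a b
      using generate_field.eng_mult[of a ring_of_type_algebra _ b] that by (simp add: K_def fraction_subfield_def)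
    show "- a \<in> K" if "a \<in> K" for a
      using generate_field.a_inv[of a ring_of_type_algebra] that by (simp add: K_def fraction_subfield_def)
  qed simp_all
  have \<kappa>_K: "\<kappa> a \<in> K" if "a \<in> R" for a
    using that unfolding K_def fraction_subfield_def by (blast intro: generate_field.incl)
  let ?S = "Poly_Mapping.keys p"
  \<comment> \<open>\<open>r\<close> is \<open>p\<close> in the format of
    \<open>algebraically_independent\<close>: exponent vectors become functions and coefficients
    move to the fraction subfield. Both changes are injective, so \<open>r = 0\<close> forces
    \<open>p = 0\<close>.\<close>
  define r where "r = (\<Sum>m\<in>?S. Poly_Mapping.single (vec_nth m) (\<kappa> (Poly_Mapping.lookup p m)))"
  have "r \<in> polys_over K"
    unfolding r_def by (intro K.sum_polys_over K.single_polys_over \<kappa>_K polys_overD[OF p])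
  moreover have "poly_eval (\<lambda>a. a) (\<lambda>m. \<Prod>i\<in>UNIV. x i ^ m i) r = 0"
    using eval unfolding r_def
    by (subst K.poly_eval_sum_single) (auto intro: \<kappa>_K polys_overD[OF p] simp: poly_eval_def)
  ultimately have r: "r = 0"
    using indep unfolding algebraically_independent_def poly_eval_def K_def polys_over_def by blast
  have "Poly_Mapping.lookup p m = 0" if "m \<in> ?S" for m
  proof -
    have "Poly_Mapping.lookup r (vec_nth m) = \<kappa> (Poly_Mapping.lookup p m)"
      unfolding r_def using that by (intro lookup_sum_single) (auto simp: inj_on_def vec_nth_inject)
    then have "\<kappa> (Poly_Mapping.lookup p m) = \<kappa> 0" by (simp add: r map_zero)
    then show ?thesis by (rule inj_onD[OF inj _ polys_overD[OF p] zero_closed])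
  qed
  then show ?thesis by (metis in_keys_iff lookup_zero poly_mapping_eqI)
qed

text \<open>The frame exponent of the monomial \<open>m\<close> in the \<open>l\<close>-th powers
  \<open>M (unit_vec i) ^ l\<close>.\<close>

definition scaled_exponent :: "nat \<Rightarrow> nat ^ 'n::finite \<Rightarrow> int ^ 'n"
  where "scaled_exponent l m = int l *s (\<chi> i. int (m $ i))"

text \<open>Distinct \<open>m\<close> give distinct exponents since \<open>l > 0\<close>, so a
  relation among \<open>l\<close>-th powers would be a relation among elements of the frame.\<close>

lemma (in root_of_unity_frame) scaled_monomials_independent:
  assumes p: "p \<in> polys_over (cyclotomic_ring \<zeta>)"
    and eval: "poly_eval \<iota> (\<lambda>m. M (scaled_exponent l m)) p = 0"
  shows "p = 0"
proof -
  have l: "l > 0" using primitive by (simp add: primitive_root_of_unity_def)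
  let ?S = "Poly_Mapping.keys p"
  define r where "r = (\<Sum>m\<in>?S. Poly_Mapping.single (scaled_exponent l m) (Poly_Mapping.lookup p m))"
  have "poly_eval \<iota> M r = poly_eval \<iota> (\<lambda>m. M (scaled_exponent l m)) p"
    unfolding r_def by (subst poly_eval_sum_single) (auto intro: polys_overD[OF p] simp: poly_eval_def)
  then have r: "r = 0"
    unfolding eval unfolding r_def
    by (rule frame_independent[rotated]) (intro sum_polys_over single_polys_over polys_overD[OF p])
  have "Poly_Mapping.lookup p m = 0" if "m \<in> ?S" for m
  proof -
    have "Poly_Mapping.lookup r (scaled_exponent l m) = Poly_Mapping.lookup p m"
      unfolding r_def using that l
      by (intro lookup_sum_single) (auto simp: inj_on_def scaled_exponent_def vec_eq_iff)
    then show ?thesis by (simp add: r)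
  qed
  then show ?thesis by (metis in_keys_iff lookup_zero poly_mapping_eqI)
qed

text \<open>Only the initial seed enters here; the other seeds are reached later by mutation.
  Leaving \<open>R\<close> general provides for both coefficient rings.\<close>

lemma seed_embedding:
  fixes x :: "'n::finite \<Rightarrow> 'g::field" and M :: "int ^ 'n \<Rightarrow> 'f::division_ring"
  assumes frame: "root_of_unity_frame l \<zeta> \<iota> \<Lambda> M"
    and \<kappa>: "algebra_map R \<kappa>" and \<iota>: "algebra_map R \<iota>" and R: "R \<subseteq> cyclotomic_ring \<zeta>"
    and seed: "classical_seed R \<kappa> ex (x, B)"
  obtains \<psi> where "\<psi> 1 = 1" "\<And>a b. \<psi> (a + b) = \<psi> a + \<psi> b" "\<And>a b. \<psi> (a * b) = \<psi> a * \<psi> b"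
    "inj \<psi>" "\<And>a. a \<in> R \<Longrightarrow> \<psi> (\<kappa> a) = \<iota> a" "\<And>i. \<psi> (x i) = M (unit_vec i) ^ l"
proof -
  interpret root_of_unity_frame l \<zeta> \<iota> \<Lambda> M by fact
  let ?y = "\<lambda>m :: nat ^ 'n. \<Prod>i\<in>UNIV. x i ^ (m $ i)"
  have inj: "inj_on \<kappa> R" and indep: "algebraically_independent (fraction_subfield R \<kappa>) x"
    and gen: "generate_field ring_of_type_algebra (fraction_subfield R \<kappa> \<union> range x) = UNIV"
    using seed by (auto simp: classical_seed_def)
  have y_unit: "?y (axis i 1) = x i" for i
  proof -
    have "?y (axis i 1) = (\<Prod>j\<in>UNIV. if j = i then x i else 1)"
      by (intro prod.cong) (auto simp: axis_component)
    then show ?thesis by simp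
  qed
  have s_0: "scaled_exponent l (0 :: nat ^ 'n) = 0"
    by (simp add: scaled_exponent_def vec_eq_iff)
  have s_unit: "scaled_exponent l (axis i 1) = int l *s unit_vec i" for i :: 'n
    by (simp add: scaled_exponent_def vec_eq_iff axis_component)
  have s_add: "M (scaled_exponent l (m + n)) = M (scaled_exponent l m) * M (scaled_exponent l n)" for m n
  proof -
    have "scaled_exponent l (m + n) = int l *s ((\<chi> i. int (m $ i)) + (\<chi> i. int (n $ i)))"
      by (simp add: scaled_exponent_def vec_eq_iff)
    then show ?thesis by (simp only: frame_scaled_add) (simp only: scaled_exponent_def)
  qed
  show thesis
  proof (rule polynomial_embedding[OF \<kappa> \<iota>, of ?y "\<lambda>m. M (scaled_exponent l m)" "range x"])
    show "p = 0" if "p \<in> polys_over R" "poly_eval \<kappa> ?y p = 0" for p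
      using monomials_independent[OF \<kappa> inj indep that] .
    show "p = 0" if "p \<in> polys_over R" "poly_eval \<iota> (\<lambda>m. M (scaled_exponent l m)) p = 0" for p
    proof (rule scaled_monomials_independent)
      show "p \<in> polys_over (cyclotomic_ring \<zeta>)" using that(1) R by (auto simp: polys_over_def)
    qed fact
    show "range x \<subseteq> range ?y"
    proof (rule image_subsetI)
      fix i
      show "x i \<in> range ?y" by (rule range_eqI[of _ _ "axis i 1"]) (simp only: y_unit)
    qed
  next
    fix \<psi> assume \<psi>: "\<psi> 1 = 1" "\<And>a b. \<psi> (a + b) = \<psi> a + \<psi> b" "\<And>a b. \<psi> (a * b) = \<psi> a * \<psi> b"
      "inj \<psi>" "\<And>a. a \<in> R \<Longrightarrow> \<psi> (\<kappa> a) = \<iota> a" "\<And>m. \<psi> (?y m) = M (scaled_exponent l m)"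
    have "\<psi> (x i) = M (unit_vec i) ^ l" for i
      using \<psi>(6)[of "axis i 1"] by (simp only: y_unit s_unit frame_power)
    with \<psi>(1-5) show thesis by (rule that)
  qed (simp_all add: s_0 s_add frame_zero gen power_add prod.distrib)
qed

section \<open>Embeddings of a field into a division ring\<close>

locale division_ring_embedding =
  fixes \<psi> :: "'g::field \<Rightarrow> 'f::division_ring"
  assumes map_one: "\<psi> 1 = 1" and map_add: "\<psi> (a + b) = \<psi> a + \<psi> b" and map_mult: "\<psi> (a * b) = \<psi> a * \<psi> b"
    and injective: "inj \<psi>"
begin

lemma map_zero: "\<psi> 0 = 0"
  using map_add[of 0 0] by simp

lemma eq_0_iff: "\<psi> a = 0 \<longleftrightarrow> a = 0"
  using inj_eq[OF injective, of a 0] by (simp add: map_zero)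

lemma map_uminus: "\<psi> (- a) = - \<psi> a"
  using map_add[of a "- a"] by (simp add: map_zero eq_neg_iff_add_eq_0 add.commute)

lemma map_power: "\<psi> (a ^ n) = \<psi> a ^ n"
  by (induction n) (simp_all add: map_one map_mult)

lemma map_inverse: "\<psi> (inverse a) = inverse (\<psi> a)"
proof (cases "a = 0")
  case False
  then have "\<psi> a * \<psi> (inverse a) = 1" by (simp add: map_one flip: map_mult)
  then show ?thesis by (simp add: inverse_unique)
qed (simp add: map_zero)

lemma image_generate_ring:
  "\<psi> ` generate_ring ring_of_type_algebra H = generate_ring ring_of_type_algebra (\<psi> ` H)"
proof (intro equalityI subsetI)
  fix b assume "b \<in> \<psi> ` generate_ring ring_of_type_algebra H"
  then obtain a where a: "a \<in> generate_ring ring_of_type_algebra H" "b = \<psi> a" by blast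
  from a(1) have "\<psi> a \<in> generate_ring ring_of_type_algebra (\<psi> ` H)"
  proof induction
    case one
    show ?case using generate_ring.one[of ring_of_type_algebra] by (simp add: map_one)
  next
    case (incl h)
    then show ?case by (blast intro: generate_ring.incl)
  next
    case (a_inv h)
    then show ?case using generate_ring.a_inv[of "\<psi> h" ring_of_type_algebra] by (simp add: map_uminus)
  next
    case (eng_add h1 h2)
    then show ?case using generate_ring.eng_add[of "\<psi> h1" ring_of_type_algebra _ "\<psi> h2"] by (simp add: map_add)
  next
    case (eng_mult h1 h2)
    then show ?case using generate_ring.eng_mult[of "\<psi> h1" ring_of_type_algebra _ "\<psi> h2"] by (simp add: map_mult)
  qed
  then show "b \<in> generate_ring ring_of_type_algebra (\<psi> ` H)" using a by simp
next
  fix b assume "b \<in> generate_ring ring_of_type_algebra (\<psi> ` H)"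
  then show "b \<in> \<psi> ` generate_ring ring_of_type_algebra H"
  proof induction
    case one
    show ?case using generate_ring.one[of ring_of_type_algebra H] by (auto simp: image_iff map_one intro!: bexI[of _ 1])
  next
    case (incl h)
    then show ?case by (blast intro: generate_ring.incl)
  next
    case (a_inv h)
    then obtain a where "a \<in> generate_ring ring_of_type_algebra H" "h = \<psi> a" by blast
    then show ?case using generate_ring.a_inv[of a ring_of_type_algebra H]
      by (auto simp: image_iff map_uminus intro!: bexI[of _ "- a"])
  next
    case (eng_add h1 h2)
    then obtain a b where "a \<in> generate_ring ring_of_type_algebra H" "h1 = \<psi> a"
      "b \<in> generate_ring ring_of_type_algebra H" "h2 = \<psi> b" by blast
    then show ?case using generate_ring.eng_add[of a ring_of_type_algebra H b]
      by (auto simp: image_iff map_add intro!: bexI[of _ "a + b"])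
  next
    case (eng_mult h1 h2)
    then obtain a b where "a \<in> generate_ring ring_of_type_algebra H" "h1 = \<psi> a"
      "b \<in> generate_ring ring_of_type_algebra H" "h2 = \<psi> b" by blast
    then show ?case using generate_ring.eng_mult[of a ring_of_type_algebra H b]
      by (auto simp: image_iff map_mult intro!: bexI[of _ "a * b"])
  qed
qed

text \<open>The isomorphism is the inverse of \<psi> on its image, because the subalgebra of the
  division ring is the source.\<close>

lemma algebra_isomorphic_image:
  assumes "\<And>a. a \<in> R \<Longrightarrow> \<psi> (\<kappa> a) = \<iota> a"
  shows "algebra_isomorphic R \<iota> (\<psi> ` S) \<kappa> S"
proof -
  let ?\<phi> = "inv_into UNIV \<psi>"
  have \<phi>: "?\<phi> (\<psi> a) = a" for a using injective by simp
  have "bij_betw ?\<phi> (\<psi> ` S) S"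
    by (rule bij_betwI[where g = \<psi>]) (auto simp: \<phi>)
  then have "?\<phi> \<in> ring_iso (subring_of_type (\<psi> ` S)) (subring_of_type S)"
    using \<phi> map_one
    by (auto simp: ring_iso_def ring_hom_def subring_of_type_def \<phi> simp flip: map_add map_mult; metis)
  moreover have "?\<phi> (\<iota> a) = \<kappa> a" if "a \<in> R" for a
    using assms[OF that] \<phi> by metis
  ultimately show ?thesis unfolding algebra_isomorphic_def by blast
qed

end

section \<open>Correspondence of seeds along mutations\<close>

text \<open>The factors added on the right have exponent 0. In this form the exponents are the ones
  that occur in the quantum mutation.\<close>

lemma exchange_monomials:
  fixes x :: "'n::finite \<Rightarrow> 'g::field" and B :: "int ^ 'n ^ 'n"
  shows "(\<Prod>i | B $ i $ k > 0. x i ^ nat (B $ i $ k)) = (\<Prod>i\<in>UNIV. x i ^ nat (nonneg_part (column k B) $ i))"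
    and "(\<Prod>i | B $ i $ k < 0. x i ^ nat (- B $ i $ k)) = (\<Prod>i\<in>UNIV. x i ^ nat ((- nonpos_part (column k B)) $ i))"
  by (rule prod.mono_neutral_cong_left; auto)+

lemma (in root_of_unity_frame) embedding_monomial:
  fixes x :: "'n \<Rightarrow> 'g::field" and c :: "int ^ 'n"
  assumes \<psi>: "division_ring_embedding \<psi>" and x: "\<And>i. \<psi> (x i) = M (unit_vec i) ^ l"
    and c: "\<And>i. c $ i \<ge> 0"
  shows "\<psi> (\<Prod>i\<in>UNIV. x i ^ nat (c $ i)) = M (int l *s c)"
proof -
  interpret E: division_ring_embedding \<psi> by fact
  have "\<psi> (\<Prod>i\<in>S. x i ^ nat (c $ i)) = M (int l *s (\<Sum>i\<in>S. c $ i *s unit_vec i))" for S :: "'n set"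
  proof (induction S rule: infinite_finite_induct)
    case (insert i S)
    have "\<psi> (x i ^ nat (c $ i)) = M (unit_vec i) ^ (l * nat (c $ i))"
      by (simp only: E.map_power x power_mult)
    also have "\<dots> = M (int l *s (c $ i *s unit_vec i))"
      using c[of i] by (simp add: frame_power vector_smult_assoc)
    finally show ?case
      using insert by (simp add: E.map_mult frame_scaled_add)
  qed (simp_all add: E.map_one frame_zero)
  from this[of UNIV] show ?thesis
    by (simp only: basis_expansion)
qed

text \<open>Induction along a mutation sequence. The claim is strengthened by the seed property,
  needed to mutate again, and by equality of exchange matrices, so that both mutations use the same
  column.\<close>

lemma cluster_variables_correspond:
  fixes M :: "int ^ 'n::finite \<Rightarrow> 'f::division_ring" and x :: "'n \<Rightarrow> 'g::field"
  assumes root: "root_of_unity l \<zeta> \<iota>"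
    and seed: "is_quantum_seed l \<zeta> \<iota> ex d (M, B)"
    and coprime: "\<forall>j\<in>ex. coprime (int l) (d j)"
    and iso: "exchange_graph_iso ex (quantum_mutation l \<zeta> \<iota>) (M, B) seed_edge (x, B) \<sigma>"
    and \<psi>: "division_ring_embedding \<psi>" and x: "\<And>i. \<psi> (x i) = M (unit_vec i) ^ l"
    and t: "t \<in> mutation_class ex (quantum_mutation l \<zeta> \<iota>) (M, B)"
  shows "\<psi> (fst (\<sigma> t) i) = fst t (unit_vec i) ^ l"
proof -
  interpret root_of_unity l \<zeta> \<iota> by fact
  interpret E: division_ring_embedding \<psi> by fact
  let ?class = "mutation_class ex (quantum_mutation l \<zeta> \<iota>) (M, B)"
  from t have "(\<lambda>u v. \<exists>k\<in>ex. quantum_mutation l \<zeta> \<iota> k u v)\<^sup>*\<^sup>* (M, B) t"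
    by (simp add: mutation_class_def)
  then have "is_quantum_seed l \<zeta> \<iota> ex d t \<and> snd (\<sigma> t) = snd t \<and>
    (\<forall>i. \<psi> (fst (\<sigma> t) i) = fst t (unit_vec i) ^ l)"
  proof induction
    case base
    then show ?case using seed iso x by (simp add: exchange_graph_iso_def)
  next
    case (step u v)
    obtain k where k: "k \<in> ex" and uv: "quantum_mutation l \<zeta> \<iota> k u v" using step.hyps(2) by blast
    have "u \<in> ?class" using step.hyps(1) by (simp add: mutation_class_def)
    \<comment> \<open>The map \<sigma> is known to respect edges only between vertices of the
      mutation class.\<close>
    moreover have "v \<in> ?class"
      using rtranclp.rtrancl_into_rtrancl[OF step.hyps] by (simp add: mutation_class_def)
    ultimately have edge: "\<sigma> v = seed_mutation k (\<sigma> u)"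
      using iso k uv unfolding exchange_graph_iso_def seed_edge_def by blast
    obtain M\<^sub>u B\<^sub>u where u: "u = (M\<^sub>u, B\<^sub>u)" by fastforce
    obtain M\<^sub>v B\<^sub>v where v: "v = (M\<^sub>v, B\<^sub>v)" by fastforce
    obtain x\<^sub>u where \<sigma>u: "\<sigma> u = (x\<^sub>u, B\<^sub>u)" using step.IH u by (metis prod.collapse snd_conv)
    have u_seed: "is_quantum_seed l \<zeta> \<iota> ex d (M\<^sub>u, B\<^sub>u)" and x\<^sub>u: "\<And>i. \<psi> (x\<^sub>u i) = M\<^sub>u (unit_vec i) ^ l"
      using step.IH u \<sigma>u by auto
    obtain \<Lambda> where "toric_frame_with_matrix l \<zeta> \<iota> \<Lambda> M\<^sub>u"
      using u_seed by (auto simp: is_quantum_seed_def)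
    then interpret F: root_of_unity_frame l \<zeta> \<iota> \<Lambda> M\<^sub>u by unfold_locales
    have mut: "quantum_mutation l \<zeta> \<iota> k (M\<^sub>u, B\<^sub>u) (M\<^sub>v, B\<^sub>v)" using uv u v by simp
    have other: "\<And>i. i \<noteq> k \<Longrightarrow> M\<^sub>v (unit_vec i) = M\<^sub>u (unit_vec i)" and B\<^sub>v: "B\<^sub>v = matrix_mutation k B\<^sub>u"
      using mut by (auto simp: quantum_mutation_def)
    note step' = quantum_mutation_step[OF u_seed mut k bspec[OF coprime k]]
    let ?b = "column k B\<^sub>u"
    let ?P = "(\<Prod>i\<in>UNIV. x\<^sub>u i ^ nat (nonneg_part ?b $ i)) + (\<Prod>i\<in>UNIV. x\<^sub>u i ^ nat ((- nonpos_part ?b) $ i))"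
    have \<sigma>v: "\<sigma> v = (x\<^sub>u(k := ?P / x\<^sub>u k), B\<^sub>v)"
      by (simp only: edge \<sigma>u seed_mutation_def prod.case exchange_monomials B\<^sub>v)
    have nz: "\<psi> (x\<^sub>u k) \<noteq> 0" by (simp add: x\<^sub>u F.frame_nonzero)
    \<comment> \<open>The new variable is compared after multiplication by the image of the old one,
      which is nonzero and is cancelled at the end.\<close>
    then have "\<psi> (?P / x\<^sub>u k) * \<psi> (x\<^sub>u k) = \<psi> ?P"
      using E.eq_0_iff[of "x\<^sub>u k"] by (simp flip: E.map_mult)
    also have "\<psi> ?P = M\<^sub>u (int l *s nonneg_part ?b) + M\<^sub>u (int l *s (- nonpos_part ?b))"
      unfolding E.map_add by (intro arg_cong2[where f = plus] F.embedding_monomial \<psi> x\<^sub>u) auto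
    also have "\<dots> = M\<^sub>v (unit_vec k) ^ l * \<psi> (x\<^sub>u k)"
      using step'(2) by (simp add: x\<^sub>u)
    finally have "\<psi> (?P / x\<^sub>u k) = M\<^sub>v (unit_vec k) ^ l"
      using nz by simp
    then show ?case
      using step'(1) x\<^sub>u other unfolding \<sigma>v by (simp add: v del: nonneg_part_nth nonpos_part_nth)
  qed
  then show ?thesis by blast
qed

text \<open>A single embedding \<psi>, built from the initial seed, carries the generators for every
  seed in \<Theta> to their quantum counterparts, hence also the intersections.\<close>

lemma central_upper_cluster_algebra_isomorphic:
  fixes M :: "int ^ 'n::finite \<Rightarrow> 'f::division_ring" and x :: "'n \<Rightarrow> 'g::field"
  assumes root: "root_of_unity l \<zeta> \<iota>"
    and seed: "is_quantum_seed l \<zeta> \<iota> ex d (M, B)"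
    and coprime: "\<forall>j\<in>ex. coprime (int l) (d j)"
    and \<Theta>: "\<Theta> \<noteq> {}" "\<Theta> \<subseteq> mutation_class ex (quantum_mutation l \<zeta> \<iota>) (M, B)"
    and R: "R \<subseteq> cyclotomic_ring \<zeta>" "1 \<in> R" "\<And>a b. a \<in> R \<Longrightarrow> b \<in> R \<Longrightarrow> a + b \<in> R"
      "\<And>a b. a \<in> R \<Longrightarrow> b \<in> R \<Longrightarrow> a * b \<in> R" "\<And>a. a \<in> R \<Longrightarrow> - a \<in> R"
    and classical: "classical_seed R \<kappa> ex (x, B)"
    and iso: "exchange_graph_iso ex (quantum_mutation l \<zeta> \<iota>) (M, B) seed_edge (x, B) \<sigma>"
  shows "algebra_isomorphic R \<iota> (central_upper_cluster_algebra R \<iota> l ex iv \<Theta>)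
    \<kappa> (upper_cluster_algebra R \<kappa> ex iv (\<sigma> ` \<Theta>))"
proof -
  interpret root_of_unity l \<zeta> \<iota> by fact
  obtain \<Lambda> where "toric_frame_with_matrix l \<zeta> \<iota> \<Lambda> M"
    using seed by (auto simp: is_quantum_seed_def)
  then have frame: "root_of_unity_frame l \<zeta> \<iota> \<Lambda> M" by unfold_locales
  have \<kappa>: "algebra_map R \<kappa>"
    by (rule algebra_mapI) (use classical R in \<open>auto simp: classical_seed_def\<close>)
  have \<iota>: "algebra_map R \<iota>"
    using R by (intro algebra_map.intro map_one map_add map_mult map_central) auto
  obtain \<psi> where \<psi>: "\<psi> 1 = 1" "\<And>a b. \<psi> (a + b) = \<psi> a + \<psi> b" "\<And>a b. \<psi> (a * b) = \<psi> a * \<psi> b" "inj \<psi>"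
    and \<psi>\<kappa>: "\<And>a. a \<in> R \<Longrightarrow> \<psi> (\<kappa> a) = \<iota> a" and \<psi>x: "\<And>i. \<psi> (x i) = M (unit_vec i) ^ l"
    by (rule seed_embedding[OF frame \<kappa> \<iota> R(1) classical]) (rule that)
  interpret E: division_ring_embedding \<psi> by unfold_locales (fact \<psi>)+
  have corr: "\<psi> (fst (\<sigma> t) i) = fst t (unit_vec i) ^ l" if "t \<in> \<Theta>" for t i
    by (rule cluster_variables_correspond[OF root seed coprime iso E.division_ring_embedding_axioms \<psi>x])
       (use that \<Theta> in blast)
  let ?U = "\<lambda>t. generated_subalgebra R \<kappa> (range (fst (\<sigma> t)) \<union> (\<lambda>i. inverse (fst (\<sigma> t) i)) ` (ex \<union> iv))"
  let ?C = "\<lambda>t. generated_subalgebra R \<iota>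
    (range (\<lambda>i. fst t (unit_vec i) ^ l) \<union> (\<lambda>i. inverse (fst t (unit_vec i) ^ l)) ` (ex \<union> iv))"
  have image: "\<psi> ` ?U t = ?C t" if "t \<in> \<Theta>" for t
  proof -
    have "\<psi> ` \<kappa> ` R = \<iota> ` R" using \<psi>\<kappa> by (force simp: image_image)
    then show ?thesis
      by (simp add: generated_subalgebra_def E.image_generate_ring image_Un image_image E.map_inverse corr[OF that])
  qed
  obtain t where t: "t \<in> \<Theta>" using \<Theta>(1) by blast
  have "upper_cluster_algebra R \<kappa> ex iv (\<sigma> ` \<Theta>) = (\<Inter>t\<in>\<Theta>. ?U t)"
    by (simp add: upper_cluster_algebra_def split_def)
  \<comment> \<open>An injective map commutes with intersections over a nonempty family;
    \<open>t\<close> witnesses nonemptiness.\<close>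
  then have "\<psi> ` upper_cluster_algebra R \<kappa> ex iv (\<sigma> ` \<Theta>) = (\<Inter>t\<in>\<Theta>. \<psi> ` ?U t)"
    using image_INT[OF \<psi>(4) _ t, of ?U] by simp
  also have "\<dots> = (\<Inter>t\<in>\<Theta>. ?C t)"
    by (intro INF_cong refl image)
  also have "\<dots> = central_upper_cluster_algebra R \<iota> l ex iv \<Theta>"
    by (simp add: central_upper_cluster_algebra_def split_def)
  finally have "\<psi> ` upper_cluster_algebra R \<kappa> ex iv (\<sigma> ` \<Theta>) = central_upper_cluster_algebra R \<iota> l ex iv \<Theta>" .
  then show ?thesis
    using E.algebra_isomorphic_image[OF \<psi>\<kappa>] by (rule subst)
qed

theorem proposition3p2:
  fixes l :: nat
    and \<zeta> :: "'k::{idom, ring_char_0} fract alg_closure"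
    and \<iota> :: "'k fract alg_closure \<Rightarrow> 'f::division_ring"
    and M :: "int ^ 'n::finite \<Rightarrow> 'f"
    and B :: "int ^ 'n ^ 'n"
    and d :: "'n \<Rightarrow> int"
    and ex iv :: "'n set"
    and \<Theta> :: "('f, 'n) quantum_seed set"
    and \<kappa> :: "'k fract alg_closure \<Rightarrow> 'g::field"
    and x :: "'n \<Rightarrow> 'g"
    and \<sigma> :: "('f, 'n) quantum_seed \<Rightarrow> ('g, 'n) seed"
    and \<kappa>\<^sub>\<epsilon> :: "'k fract alg_closure \<Rightarrow> 'h::field"
    and x\<^sub>\<epsilon> :: "'n \<Rightarrow> 'h"
    and \<sigma>\<^sub>\<epsilon> :: "('f, 'n) quantum_seed \<Rightarrow> ('h, 'n) seed"
  assumes "iv \<inter> ex = {}"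
    and "primitive_root_of_unity l \<zeta>"
    and "algebra_structure (cyclotomic_ring \<zeta>) \<iota>"
    and "is_quantum_seed l \<zeta> \<iota> ex d (M, B)"
    and "\<Theta> \<noteq> {}"
    and "\<Theta> \<subseteq> mutation_class ex (quantum_mutation l \<zeta> \<iota>) (M, B)"
    and "odd l"
    and "\<forall>j\<in>ex. coprime (int l) (d j)"
  shows
    "(classical_seed base_ring \<kappa> ex (x, B) \<and>
      exchange_graph_iso ex (quantum_mutation l \<zeta> \<iota>) (M, B) seed_edge (x, B) \<sigma> \<longrightarrow>
        algebra_isomorphic base_ring
          \<iota> (central_upper_cluster_algebra base_ring \<iota> l ex iv \<Theta>)
          \<kappa> (upper_cluster_algebra base_ring \<kappa> ex iv (\<sigma> ` \<Theta>))) \<and>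
     (classical_seed (cyclotomic_ring \<zeta>) \<kappa>\<^sub>\<epsilon> ex (x\<^sub>\<epsilon>, B) \<and>
      exchange_graph_iso ex (quantum_mutation l \<zeta> \<iota>) (M, B) seed_edge (x\<^sub>\<epsilon>, B) \<sigma>\<^sub>\<epsilon> \<longrightarrow>
        algebra_isomorphic (cyclotomic_ring \<zeta>)
          \<iota> (central_upper_cluster_algebra (cyclotomic_ring \<zeta>) \<iota> l ex iv \<Theta>)
          \<kappa>\<^sub>\<epsilon> (upper_cluster_algebra (cyclotomic_ring \<zeta>) \<kappa>\<^sub>\<epsilon> ex iv (\<sigma>\<^sub>\<epsilon> ` \<Theta>)))"
proof -
  have root: "root_of_unity l \<zeta> \<iota>"
    using assms by unfold_locales
  note iso = central_upper_cluster_algebra_isomorphic[OF root assms(4,8,5,6)]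
  \<comment> \<open>The two claims are the cases \<open>R = base_ring\<close> and
    \<open>R = cyclotomic_ring \<zeta>\<close> of one statement.\<close>
  show ?thesis
    using iso[OF base_ring_subset_cyclotomic_ring base_ring_closed]
      iso[OF subset_refl cyclotomic_ring_closed] by blast
qed

end
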